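(* Let $H_0:\mathbb{R}\to\mathbb{R}$ be of class $C^1$ with derivative $H_0'$ strictly increasing and locally Lipschitz (for every $P>0$ there is $C>0$ with $|H_0'(p_1)-H_0'(p_2)|\le C|p_1-p_2|$ for all $p_1,p_2\in[-P,P]$), and such that for every $N>0$ there is $P>0$ with $H_0(p)>N|p|$ whenever $|p|>P$. Let $U:\mathbb{R}^2\to\mathbb{R}$, $(t,x)\mapsto U(t,x)$, be of class $C^1$ with $\partial U/\partial x$ Lipschitz and $U(t+1,x)=U(t,x+1)=U(t,x)$ for all $(t,x)\in\mathbb{R}^2$. Then there is a convex function $H:\mathbb{R}\to\mathbb{R}$ satisfying $$\min_{(t,x)\in\mathbb{R}^2}U(t,x)\le H(a)-H_0(a)\le\max_{(t,x)\in\mathbb{R}^2}U(t,x)\qquad\text{for all }a\in\mathbb{R},$$ such that for every $a\in\mathbb{R}$ there exists a continuous function $s^a:\mathbb{R}^2\to\mathbb{R}$, periodic with period $1$ in each of $t$ and $x$, for which $$S^a(t,x)=ax-H(a)t+s^a(t,x)$$ is a viscosity solution of the Hamilton--Jacobi equation $$\frac{\partial S}{\partial t}+H_0\left(\frac{\partial S}{\partial x}\right)+U(t,x)=0 .$$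
   Context: Viscosity solution (Crandall--Lions): a continuous function $S$ is a viscosity solution of $\partial_t S+H_0(\partial_x S)+U(t,x)=0$ if for every $C^1$ function $\varphi$, at every local maximum point $(t_0,x_0)$ of $S-\varphi$ one has $\partial_t\varphi+H_0(\partial_x\varphi)+U\le 0$ at $(t_0,x_0)$, and at every local minimum point $(t_0,x_0)$ of $S-\varphi$ one has $\partial_t\varphi+H_0(\partial_x\varphi)+U\ge0$ at $(t_0,x_0)$. The paper works with viscosity solutions through the well-known Lax--Oleinik formula: for initial data $S_0(x)=ax+s_0(x)$ with $s_0$ continuous and 1-periodic, the viscosity solution of the Cauchy problem for $t>0$ is $S(t,x)=\inf_{y\in\mathbb{R}}(S_0(y)+L(0,y;t,x))$, where $L(s,y;t,x)$ is the infimum of $\int_s^t[L_0(\xi'(\tau))-U(\tau,\xi(\tau))]\,d\tau$ over absolutely continuous $\xi:[s,t]\to\mathbb{R}$ with $\xi(s)=y$, $\xi(t)=x$ and integrable integrand, and $L_0(v)=\max_{p\in\mathbb{R}}(pv-H_0(p))$ is the Legendre transform of $H_0$. *)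

theory Defs
  imports "HOL-Analysis.Analysis"
begin

text \<open>Points of the plane are pairs \<open>(t, x)\<close> of time and position.\<close>

definition partial_t :: "(real \<times> real \<Rightarrow> real) \<Rightarrow> real \<times> real \<Rightarrow> real" where
  "partial_t f = (\<lambda>(t, x). deriv (\<lambda>s. f (s, x)) t)"

definition partial_x :: "(real \<times> real \<Rightarrow> real) \<Rightarrow> real \<times> real \<Rightarrow> real" where
  "partial_x f = (\<lambda>(t, x). deriv (\<lambda>y. f (t, y)) x)"

text \<open>Since \<^const>\<open>deriv\<close> is total, differentiability is required separately; it guarantees
  that both partial derivatives exist.\<close>

definition C1_plane :: "(real \<times> real \<Rightarrow> real) \<Rightarrow> bool" where
  "C1_plane f \<longleftrightarrow> f differentiable_on UNIV \<and>
     continuous_on UNIV (partial_t f) \<and> continuous_on UNIV (partial_x f)"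

definition local_max_at :: "('a::topological_space \<Rightarrow> real) \<Rightarrow> 'a \<Rightarrow> bool" where
  "local_max_at f z \<longleftrightarrow> (\<forall>\<^sub>F w in nhds z. f w \<le> f z)"

definition local_min_at :: "('a::topological_space \<Rightarrow> real) \<Rightarrow> 'a \<Rightarrow> bool" where
  "local_min_at f z \<longleftrightarrow> (\<forall>\<^sub>F w in nhds z. f z \<le> f w)"

text \<open>Viscosity solutions, in the sense of Crandall and Lions, of
  \<open>\<partial>\<^sub>t S + H\<^sub>0 (\<partial>\<^sub>x S) + U = 0\<close> on the whole plane.\<close>

definition viscosity_solution ::
    "(real \<Rightarrow> real) \<Rightarrow> (real \<times> real \<Rightarrow> real) \<Rightarrow> (real \<times> real \<Rightarrow> real) \<Rightarrow> bool" where
  "viscosity_solution H0 U S \<longleftrightarrow>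
     continuous_on UNIV S \<and>
     (\<forall>\<phi>. C1_plane \<phi> \<longrightarrow>
       (\<forall>z. local_max_at (\<lambda>w. S w - \<phi> w) z \<longrightarrow>
            partial_t \<phi> z + H0 (partial_x \<phi> z) + U z \<le> 0) \<and>
       (\<forall>z. local_min_at (\<lambda>w. S w - \<phi> w) z \<longrightarrow>
            partial_t \<phi> z + H0 (partial_x \<phi> z) + U z \<ge> 0))"

definition periodic_plane :: "(real \<times> real \<Rightarrow> real) \<Rightarrow> bool" where
  "periodic_plane f \<longleftrightarrow> (\<forall>t x. f (t + 1, x) = f (t, x) \<and> f (t, x + 1) = f (t, x))"

end

theory Submission
  imports Defs "HOL-Complex_Analysis.Great_Picard"
begin

text \<open>Instead of the Lax--Oleinik formula, consider the value function of a discounted control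
  problem in discrete time: the infimum, over sequences of velocities, of the discounted sums of
  \<open>L v - a v - U\<close> along the backward broken path through a point. It is periodic, and an infimum
  of affine functions of \<open>a\<close>; hence minus the discount rate times its value at the origin is convex
  in \<open>a\<close>, and so is the upper limit \<open>H\<close> as step and discount tend to 0 together. The value
  functions, normalised at the origin, are Lipschitz uniformly up to a vanishing error, so along a
  subsequence realising the upper limit they converge uniformly. The one-step dynamic programming
  principle is a monotone and consistent scheme for the cell problem, whence the limit is a
  viscosity solution.\<close>

section \<open>Functions on the plane\<close>

text \<open>Discrete time keeps the variational side elementary: paths are sequences, actions are
  sums, and almost optimal controls stand in for minimisers throughout. The discount turns evolution
  into a stationary problem. The value function is of the order of the inverse rate while its
  oscillation stays bounded, so rate times value is nearly constant in the plane; that constant, up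
  to sign, is the candidate for \<open>H a\<close>. The upper limit is taken because it always
  exists, is subadditive, so that convexity survives, and is realised along some subsequence for
  each \<open>a\<close> separately. The delicate point is a Lipschitz bound independent of step and
  rate: it compares nearly optimal paths over exactly one time period, at the end of which
  periodicity returns the value function to itself and discounting has cost only a bounded
  amount.\<close>

lemma C1_plane_has_derivative:
  assumes "C1_plane f"
  shows "(f has_derivative (\<lambda>d. partial_t f z * fst d + partial_x f z * snd d)) (at z)"
proof -
  obtain t x where z: "z = (t, x)" by force
  obtain D where D: "(f has_derivative D) (at (t, x))"
    using assms unfolding C1_plane_def differentiable_on_def differentiable_def z by auto
  interpret D: bounded_linear D using D by (rule has_derivative_bounded_linear)
  have D_eq: "D d = D (1, 0) * fst d + D (0, 1) * snd d" for d
  proof -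
    have "d = fst d *\<^sub>R (1, 0) + snd d *\<^sub>R (0, 1)"
      by (simp add: prod_eq_iff)
    then have "D d = D (fst d *\<^sub>R (1, 0) + snd d *\<^sub>R (0, 1))" by simp
    also have "\<dots> = D (1, 0) * fst d + D (0, 1) * snd d"
      by (simp only: D.add D.scaleR real_scaleR_def mult.commute)
    finally show ?thesis .
  qed
  have "((\<lambda>s. f (s, x)) has_derivative (\<lambda>h. D (h, 0))) (at t)"
    by (rule has_derivative_compose[of "\<lambda>s. (s, x)" "\<lambda>h. (h, 0)", OF _ D])
       (auto intro!: derivative_eq_intros)
  moreover have "(\<lambda>h. D (h, 0)) = (*) (D (1, 0))" by (subst D_eq) auto
  ultimately have "partial_t f z = D (1, 0)"
    by (simp add: z partial_t_def has_field_derivative_def DERIV_imp_deriv)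
  moreover have "((\<lambda>y. f (t, y)) has_derivative (\<lambda>h. D (0, h))) (at x)"
    by (rule has_derivative_compose[of "\<lambda>y. (t, y)" "\<lambda>h. (0, h)", OF _ D])
       (auto intro!: derivative_eq_intros)
  moreover have "(\<lambda>h. D (0, h)) = (*) (D (0, 1))" by (subst D_eq) auto
  ultimately have "partial_x f z = D (0, 1)"
    by (simp add: z partial_x_def has_field_derivative_def DERIV_imp_deriv)
  with \<open>partial_t f z = D (1, 0)\<close> have "D = (\<lambda>d. partial_t f z * fst d + partial_x f z * snd d)"
    using D_eq by (intro ext) metis
  with D z show ?thesis by simp
qed

text \<open>The mean value theorem along the segment gives both partials at one and the same point,
  which later tends to the test point together with the ends of the segment.\<close>

lemma mean_value_plane:
  fixes f :: "real \<times> real \<Rightarrow> real"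
  assumes f': "\<And>z. (f has_derivative (\<lambda>d. A z * fst d + B z * snd d)) (at z)"
  shows "\<exists>\<xi>\<in>closed_segment w z. f z - f w = A \<xi> * (fst z - fst w) + B \<xi> * (snd z - snd w)"
proof -
  let ?g = "\<lambda>\<theta>. w + \<theta> *\<^sub>R (z - w)"
  have "\<exists>\<theta>\<in>{0<..<1}. f (?g 1) - f (?g 0) =
    (\<lambda>h. A (?g \<theta>) * fst (h *\<^sub>R (z - w)) + B (?g \<theta>) * snd (h *\<^sub>R (z - w))) (1 - 0)"
  proof (rule mvt_simple)
    fix \<theta> :: real
    have "((\<lambda>\<theta>. f (?g \<theta>)) has_derivative
        (\<lambda>h. A (?g \<theta>) * fst (h *\<^sub>R (z - w)) + B (?g \<theta>) * snd (h *\<^sub>R (z - w)))) (at \<theta>)"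
      by (rule has_derivative_compose[of ?g "\<lambda>h. h *\<^sub>R (z - w)", OF _ f'])
         (auto intro!: derivative_eq_intros)
    then show "((\<lambda>\<theta>. f (?g \<theta>)) has_derivative
        (\<lambda>h. A (?g \<theta>) * fst (h *\<^sub>R (z - w)) + B (?g \<theta>) * snd (h *\<^sub>R (z - w))))
        (at \<theta> within {0..1})"
      by (rule has_derivative_at_withinI)
  qed simp
  then obtain \<theta> where \<theta>: "0 < \<theta>" "\<theta> < 1"
    and eq: "f z - f w = A (?g \<theta>) * (fst z - fst w) + B (?g \<theta>) * (snd z - snd w)"
    by auto
  have "?g \<theta> \<in> closed_segment w z"
    using \<theta> by (auto simp: in_segment algebra_simps intro!: exI[of _ \<theta>])
  with eq show ?thesis by blast
qed

section \<open>Functions periodic in both variables\<close>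

lemma periodic_plane_of_int:
  assumes "periodic_plane f"
  shows "f (t + of_int k, x + of_int l) = f (t, x)"
proof -
  have T: "f (s + of_nat j, y) = f (s, y)" for s y j
    by (induction j) (use assms in \<open>auto simp: periodic_plane_def algebra_simps,
      metis add.assoc add.commute\<close>)
  have X: "f (s, y + of_nat j) = f (s, y)" for s y j
    by (induction j) (use assms in \<open>auto simp: periodic_plane_def algebra_simps,
      metis add.assoc add.commute\<close>)
  have T': "f (s + of_int k, y) = f (s, y)" for s y
    using T[of s "nat k" y] T[of "s + of_int k" "nat (-k)" y] by (cases "k \<ge> 0") auto
  have X': "f (s, y + of_int l) = f (s, y)" for s y
    using X[of s y "nat l"] X[of s "y + of_int l" "nat (-l)"] by (cases "l \<ge> 0") auto
  show ?thesis by (simp add: T' X')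
qed

lemma periodic_plane_frac:
  assumes "periodic_plane f"
  shows "f (t, x) = f (frac t, frac x)"
  using periodic_plane_of_int[OF assms, of "frac t" "\<lfloor>t\<rfloor>" "frac x" "\<lfloor>x\<rfloor>"]
  by (simp add: frac_def)

lemma frac_pair_in_unit_square: "(frac t, frac x) \<in> cbox (0, 0) (1, 1)" for t x :: real
  using frac_lt_1[of t] frac_lt_1[of x] unfolding cbox_Pair_eq cbox_interval
  by (simp add: less_imp_le)

lemma range_periodic_plane:
  assumes "periodic_plane f"
  shows "range f = f ` cbox (0, 0) (1, 1)"
proof
  show "range f \<subseteq> f ` cbox (0, 0) (1, 1)"
  proof
    fix u assume "u \<in> range f"
    then obtain t x where "u = f (t, x)" by auto
    then show "u \<in> f ` cbox (0, 0) (1, 1)"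
      using periodic_plane_frac[OF assms] frac_pair_in_unit_square by (metis image_eqI)
  qed
qed auto

lemma compact_range_periodic_plane:
  fixes f :: "real \<times> real \<Rightarrow> real"
  assumes "periodic_plane f" "continuous_on UNIV f"
  shows "compact (range f)"
  unfolding range_periodic_plane[OF assms(1)]
  by (intro compact_continuous_image compact_cbox continuous_on_subset[OF assms(2)]) auto

text \<open>Over the reals, \<open>LEAST\<close> and \<open>GREATEST\<close> carry information only
  when the extreme values are attained; the compact range of a continuous periodic function provides
  this.\<close>

lemma LEAST_GREATEST_range_bounds:
  fixes f :: "real \<times> real \<Rightarrow> real"
  assumes "periodic_plane f" "continuous_on UNIV f"
  shows "(LEAST u. u \<in> range f) \<le> f z" "f z \<le> (GREATEST u. u \<in> range f)"
proof -
  have c: "compact (range f)" by (rule compact_range_periodic_plane[OF assms])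
  obtain m where m: "m \<in> range f" "\<forall>y\<in>range f. m \<le> y" using compact_attains_inf[OF c] by auto
  obtain M where M: "M \<in> range f" "\<forall>y\<in>range f. y \<le> M" using compact_attains_sup[OF c] by auto
  have "(LEAST u. u \<in> range f) = m" using m by (intro Least_equality) auto
  moreover have "(GREATEST u. u \<in> range f) = M" using M by (intro Greatest_equality) auto
  ultimately show "(LEAST u. u \<in> range f) \<le> f z" "f z \<le> (GREATEST u. u \<in> range f)"
    using m(2) M(2) by blast+
qed

text \<open>Periodicity passes to the partials, so their continuity bounds them on the whole plane,
  and the mean value formula turns the bounds into a global constant.\<close>

lemma C1_periodic_imp_lipschitz:
  assumes C1: "C1_plane f" and per: "periodic_plane f"
  shows "\<exists>K\<ge>0. \<forall>t s x y. \<bar>f (t, x) - f (s, y)\<bar> \<le> K * (\<bar>t - s\<bar> + \<bar>x - y\<bar>)"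
proof -
  have "periodic_plane (partial_t f)" "periodic_plane (partial_x f)"
  proof -
    have shift: "deriv g (u + 1) = deriv g u" if "\<And>r. g (r + 1) = g r" for g :: "real \<Rightarrow> real" and u
    proof -
      have "g (u + 1 + x) = g (u + x)" for x
        using that[of "u + x"] by (simp add: algebra_simps)
      then show ?thesis
        using deriv_shift_0[of g "u + 1"] deriv_shift_0[of g u] by (simp add: o_def)
    qed
    show "periodic_plane (partial_t f)" "periodic_plane (partial_x f)"
      using per by (auto simp: periodic_plane_def partial_t_def partial_x_def intro!: shift)
  qed
  then have "bounded (range (partial_t f))" "bounded (range (partial_x f))"
    using C1 compact_range_periodic_plane compact_imp_bounded unfolding C1_plane_def by blast+
  then obtain a b where a: "\<And>z. \<bar>partial_t f z\<bar> \<le> a" and b: "\<And>z. \<bar>partial_x f z\<bar> \<le> b"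
    unfolding bounded_iff by auto
  have ab: "0 \<le> a" "0 \<le> b" using a[of 0] b[of 0] by linarith+
  show ?thesis
  proof (intro exI[of _ "a + b"] conjI allI)
    fix t s x y
    obtain \<xi> where \<xi>: "f (t, x) - f (s, y) = partial_t f \<xi> * (t - s) + partial_x f \<xi> * (x - y)"
      using mean_value_plane[OF C1_plane_has_derivative[OF C1], of "(s, y)" "(t, x)"] by auto
    have "\<bar>f (t, x) - f (s, y)\<bar> \<le> a * \<bar>t - s\<bar> + b * \<bar>x - y\<bar>"
      unfolding \<xi> using a[of \<xi>] b[of \<xi>]
      by (intro order.trans[OF abs_triangle_ineq] add_mono)
         (auto simp: abs_mult intro: mult_right_mono)
    also have "\<dots> \<le> (a + b) * (\<bar>t - s\<bar> + \<bar>x - y\<bar>)"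
      using ab by (simp add: algebra_simps)
    finally show "\<bar>f (t, x) - f (s, y)\<bar> \<le> (a + b) * (\<bar>t - s\<bar> + \<bar>x - y\<bar>)" .
  qed (use ab in auto)
qed

text \<open>Subtracting the squared distance makes the maximum strict, so that almost maximal points
  of the approximants are forced to converge to it.\<close>

lemma almost_maximal_points:
  fixes f :: "nat \<Rightarrow> 'a::euclidean_space \<Rightarrow> real"
  assumes unif: "uniform_limit UNIV f s sequentially"
    and max: "local_max_at (\<lambda>w. s w - \<psi> w) z"
    and e: "\<And>n. 0 < e n" "e \<longlonglongrightarrow> 0"
  obtains r \<zeta> where "r > 0" "\<zeta> \<longlonglongrightarrow> z"
    "\<forall>\<^sub>F n in sequentially. \<forall>w\<in>cball z r.
      f n w - \<psi> w - (dist w z)\<^sup>2 \<le> f n (\<zeta> n) - \<psi> (\<zeta> n) - (dist (\<zeta> n) z)\<^sup>2 + e n"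
proof -
  obtain r where r: "r > 0" "\<And>w. w \<in> cball z r \<Longrightarrow> s w - \<psi> w \<le> s z - \<psi> z"
  proof -
    obtain r' where "r' > 0" "\<And>w. dist w z < r' \<Longrightarrow> s w - \<psi> w \<le> s z - \<psi> z"
      using max unfolding local_max_at_def eventually_nhds_metric by auto
    then show ?thesis by (intro that[of "r' / 2"]) (auto simp: dist_commute)
  qed
  define F where "F n w = f n w - \<psi> w - (dist w z)\<^sup>2" for n w
  \<comment> \<open>The functions \<open>f n\<close> are not assumed continuous, so a maximiser over
    the ball may fail to exist; a point within \<open>e n\<close> of the supremum replaces
    it.\<close>
  define \<zeta> where "\<zeta> n = (SOME \<zeta>. \<zeta> \<in> cball z r \<and> (\<forall>w\<in>cball z r. F n w \<le> F n \<zeta> + e n))" for n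
  have near: "\<forall>\<^sub>F n in sequentially. \<forall>w. \<bar>f n w - s w\<bar> < d" if "d > 0" for d
    using uniform_limitD[OF unif that] by (simp add: dist_real_def)
  have \<zeta>: "\<forall>\<^sub>F n in sequentially. \<zeta> n \<in> cball z r \<and> (\<forall>w\<in>cball z r. F n w \<le> F n (\<zeta> n) + e n)"
    using near[OF zero_less_one]
  proof eventually_elim
    case (elim n)
    have bdd: "bdd_above (F n ` cball z r)"
    proof (rule bdd_aboveI2)
      fix w assume "w \<in> cball z r"
      then show "F n w \<le> s z - \<psi> z + 1"
        using r(2)[of w] elim[rule_format, of w] zero_le_power2[of "dist w z"]
        unfolding F_def by linarith
    qed
    have ne: "F n ` cball z r \<noteq> {}" using r by auto
    obtain \<zeta>' where "\<zeta>' \<in> cball z r" "(SUP w\<in>cball z r. F n w) - e n < F n \<zeta>'"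
      using less_cSUP_iff[OF _ bdd, of "(SUP w\<in>cball z r. F n w) - e n"] e(1)[of n] ne by auto
    moreover have "F n w \<le> (SUP w\<in>cball z r. F n w)" if "w \<in> cball z r" for w
      using that bdd by (rule cSUP_upper)
    ultimately have "\<exists>\<zeta>. \<zeta> \<in> cball z r \<and> (\<forall>w\<in>cball z r. F n w \<le> F n \<zeta> + e n)"
      by (intro exI[of _ \<zeta>']) force
    then show ?case unfolding \<zeta>_def by (rule someI_ex)
  qed
  have "\<zeta> \<longlonglongrightarrow> z"
  proof (rule tendstoI)
    fix d :: real assume "d > 0"
    \<comment> \<open>Three errors enter below: the distance of \<open>f n\<close> to
      \<open>s\<close> at two points, and \<open>e n\<close>. At \<open>d\<^sup>2 / 4\<close> each,
      they stay below \<open>d\<^sup>2\<close> in total.\<close>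
    then have d: "d\<^sup>2 / 4 > 0" by simp
    have "\<forall>\<^sub>F n in sequentially. e n < d\<^sup>2 / 4" using order_tendstoD(2)[OF e(2) d] .
    with \<zeta> near[OF d] show "\<forall>\<^sub>F n in sequentially. dist (\<zeta> n) z < d"
    proof eventually_elim
      case (elim n)
      have "F n z \<le> F n (\<zeta> n) + e n" using elim r by auto
      moreover have "s (\<zeta> n) - \<psi> (\<zeta> n) \<le> s z - \<psi> z" using elim r by auto
      moreover have "\<bar>f n z - s z\<bar> < d\<^sup>2 / 4" "\<bar>f n (\<zeta> n) - s (\<zeta> n)\<bar> < d\<^sup>2 / 4" using elim by auto
      moreover have "e n < d\<^sup>2 / 4" using elim by auto
      ultimately have "(dist (\<zeta> n) z)\<^sup>2 < d\<^sup>2 / 4 + d\<^sup>2 / 4 + d\<^sup>2 / 4"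
        unfolding F_def abs_less_iff by simp
      also have "\<dots> \<le> d\<^sup>2" by simp
      finally have "(dist (\<zeta> n) z)\<^sup>2 < d\<^sup>2" .
      then show ?case using \<open>d > 0\<close> by (simp add: power2_less_imp_less)
    qed
  qed
  with r(1) \<zeta> show ?thesis unfolding F_def by (intro that) (auto elim: eventually_mono)
qed

text \<open>Infimal convolution with the cone \<open>C * dist\<close> moves \<open>w n\<close> by at
  most \<open>e n\<close>, so it has the same uniform limits. Periodicity carries the uniform
  convergence from the unit square to the plane.\<close>

lemma asymptotically_lipschitz_subsequence:
  fixes w :: "nat \<Rightarrow> real \<times> real \<Rightarrow> real"
  assumes per: "\<And>n. periodic_plane (w n)"
    and lip: "\<And>n y z. \<bar>w n y - w n z\<bar> \<le> C * dist y z + e n"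
    and C: "C \<ge> 0" and e: "e \<longlonglongrightarrow> 0" and w0: "\<And>n. w n 0 = 0"
  obtains r s where "strict_mono (r :: nat \<Rightarrow> nat)" "uniform_limit UNIV (\<lambda>k. w (r k)) s sequentially"
    "continuous_on UNIV s" "periodic_plane s"
proof -
  let ?Q = "cbox (0, 0) (1, 1) :: (real \<times> real) set"
  \<comment> \<open>The infimal convolutions are equi-Lipschitz without error term, so Arzela--Ascoli applies to them.\<close>
  define v where "v n z = (INF y. w n y + C * dist y z)" for n z
  have lower: "w n z - e n \<le> w n y + C * dist y z" for n y z
    using lip[of n z y] by (simp add: dist_commute)
  have bdd: "bdd_below (range (\<lambda>y. w n y + C * dist y z))" for n z
    using lower by (intro bdd_belowI2[of _ "w n z - e n"]) auto
  have v_le: "v n z \<le> w n y + C * dist y z" for n y z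
    unfolding v_def by (rule cINF_lower[OF bdd]) simp
  have v_ge: "w n z - e n \<le> v n z" for n z
    unfolding v_def by (rule cINF_greatest) (use lower in auto)
  have v_lip: "v n y \<le> v n z + C * dist y z" for n y z
  proof -
    have "v n y - C * dist y z \<le> w n u + C * dist u z" for u
    proof -
      have "C * dist u y \<le> C * dist u z + C * dist y z"
        using mult_left_mono[OF dist_triangle2[of u y z] C] by (simp add: distrib_left)
      then show ?thesis using v_le[of n y u] by linarith
    qed
    then have "v n y - C * dist y z \<le> v n z" unfolding v_def[of n z] by (intro cINF_greatest) auto
    then show ?thesis by simp
  qed
  have close: "\<bar>w n z - v n z\<bar> \<le> e n" for n z
    using v_le[of n z z] v_ge[of n z] by simp
  obtain E where E: "\<And>n. \<bar>e n\<bar> \<le> E"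
    using convergent_imp_Bseq[OF convergentI[OF e]] by (auto simp: Bseq_def)
  obtain D where D: "\<And>z. z \<in> ?Q \<Longrightarrow> norm z \<le> D"
    using bounded_cbox[of "(0, 0) :: real \<times> real" "(1, 1)"] unfolding bounded_iff by blast
  obtain g k where g: "continuous_on ?Q g" "strict_mono (k :: nat \<Rightarrow> nat)"
    and lim: "\<And>e. 0 < e \<Longrightarrow> \<exists>N. \<forall>n x. n \<ge> N \<and> x \<in> ?Q \<longrightarrow> norm (v (k n) x - g x) < e"
  proof (rule Arzela_Ascoli[of ?Q v "2 * E + C * D"])
    show "norm (v n z) \<le> 2 * E + C * D" if "z \<in> ?Q" for n z
    proof -
      have "\<bar>w n z\<bar> \<le> C * norm z + e n" using lip[of n z 0] w0 by (simp add: dist_norm)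
      moreover have "C * norm z \<le> C * D" using D[OF that] C by (rule mult_left_mono)
      ultimately show ?thesis using close[of n z] E[of n] by (simp add: abs_le_iff)
    qed
    show "\<exists>d. 0 < d \<and> (\<forall>n y. y \<in> ?Q \<and> norm (z - y) < d \<longrightarrow> norm (v n z - v n y) < \<epsilon>)"
      if "0 < \<epsilon>" for z \<epsilon>
    proof (intro exI[of _ "\<epsilon> / (C + 1)"] conjI allI impI)
      show "0 < \<epsilon> / (C + 1)" using that C by simp
      fix n y assume "y \<in> ?Q \<and> norm (z - y) < \<epsilon> / (C + 1)"
      then have "(C + 1) * dist z y < \<epsilon>" using C by (simp add: dist_norm field_simps)
      then have "C * dist z y < \<epsilon>"
        by (simp add: distrib_right) (use zero_le_dist[of z y] in linarith)
      then show "norm (v n z - v n y) < \<epsilon>"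
        using v_lip[of n z y] v_lip[of n y z] by (simp add: dist_commute abs_less_iff)
    qed
  qed auto
  \<comment> \<open>At integer coordinates \<open>frac\<close> jumps, so continuity of
    \<open>s\<close> is not read off from \<open>g\<close>; it follows below from the Lipschitz
    estimate, whose error term vanishes in the limit.\<close>
  define s where "s z = g (frac (fst z), frac (snd z))" for z
  have ek: "(\<lambda>n. e (k n)) \<longlonglongrightarrow> 0" using LIMSEQ_subseq_LIMSEQ[OF e g(2)] by (simp add: o_def)
  have unif: "uniform_limit UNIV (\<lambda>n. w (k n)) s sequentially"
  proof (rule uniform_limitI)
    fix \<epsilon> :: real assume \<epsilon>: "0 < \<epsilon>"
    obtain N where N: "\<And>n x. n \<ge> N \<Longrightarrow> x \<in> ?Q \<Longrightarrow> norm (v (k n) x - g x) < \<epsilon> / 2"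
      using lim[of "\<epsilon> / 2"] half_gt_zero[OF \<epsilon>] by blast
    have "\<forall>\<^sub>F n in sequentially. e (k n) < \<epsilon> / 2" using order_tendstoD(2)[OF ek half_gt_zero[OF \<epsilon>]] .
    with eventually_ge_at_top[of N]
    show "\<forall>\<^sub>F n in sequentially. \<forall>z\<in>UNIV. dist (w (k n) z) (s z) < \<epsilon>"
    proof eventually_elim
      case (elim n)
      show ?case
      proof
        fix z :: "real \<times> real"
        let ?y = "(frac (fst z), frac (snd z))"
        have "w (k n) z = w (k n) ?y"
          using periodic_plane_frac[OF per, of "k n" "fst z" "snd z"] by simp
        moreover have "norm (v (k n) ?y - g ?y) < \<epsilon> / 2"
          using N elim frac_pair_in_unit_square by blast
        ultimately show "dist (w (k n) z) (s z) < \<epsilon>"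
          using close[of "k n" ?y] elim unfolding s_def dist_real_def real_norm_def by linarith
      qed
    qed
  qed
  have ptw: "(\<lambda>n. w (k n) z) \<longlonglongrightarrow> s z" for z
    using tendsto_uniform_limitI[OF unif] by auto
  have "\<bar>s y - s z\<bar> \<le> C * dist y z" for y z
  proof -
    have "(\<lambda>n. C * dist y z + e (k n)) \<longlonglongrightarrow> C * dist y z + 0" by (intro tendsto_intros ek)
    moreover have "(\<lambda>n. \<bar>w (k n) y - w (k n) z\<bar>) \<longlonglongrightarrow> \<bar>s y - s z\<bar>" by (intro tendsto_intros ptw)
    ultimately show ?thesis using lip by (intro LIMSEQ_le[rotated 2]) auto
  qed
  then have "C-lipschitz_on UNIV s" using C by (intro lipschitz_onI) (auto simp: dist_real_def)
  then have "continuous_on UNIV s" by (rule lipschitz_on_continuous_on)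
  moreover have "periodic_plane s" unfolding periodic_plane_def s_def by (simp add: frac_1_eq)
  ultimately show ?thesis using that g(2) unif by blast
qed

lemma tendsto_in_closed_segment:
  fixes x y \<xi> :: "nat \<Rightarrow> 'a::euclidean_space"
  assumes "x \<longlonglongrightarrow> z" "y \<longlonglongrightarrow> z" "\<And>n. \<xi> n \<in> closed_segment (x n) (y n)"
  shows "\<xi> \<longlonglongrightarrow> z"
proof -
  have lim: "(\<lambda>n. dist (x n) (y n)) \<longlonglongrightarrow> 0" using tendsto_dist[OF assms(1,2)] by simp
  have "norm (\<xi> n - x n) \<le> dist (x n) (y n)" for n
    using dist_in_closed_segment[OF assms(3)] unfolding dist_norm[symmetric] by blast
  then have "(\<lambda>n. \<xi> n - x n) \<longlonglongrightarrow> 0"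
    by (intro Lim_null_comparison[OF always_eventually lim]) blast
  from tendsto_add[OF this assms(1)] show ?thesis by simp
qed

lemma limsup_ereal_bounded:
  fixes f :: "nat \<Rightarrow> real"
  assumes "\<forall>\<^sub>F n in sequentially. b \<le> f n \<and> f n \<le> c"
  shows "\<exists>l. limsup (\<lambda>n. ereal (f n)) = ereal l \<and> b \<le> l \<and> l \<le> c"
proof -
  have "ereal b \<le> limsup (\<lambda>n. ereal (f n))"
    using eventually_mono[OF assms, of "\<lambda>n. ereal b \<le> ereal (f n)"] by (intro le_Limsup) simp_all
  moreover have "limsup (\<lambda>n. ereal (f n)) \<le> ereal c"
    using eventually_mono[OF assms, of "\<lambda>n. ereal (f n) \<le> ereal c"] by (intro Limsup_bounded) simp_all
  ultimately show ?thesis by (cases "limsup (\<lambda>n. ereal (f n))") auto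
qed

section \<open>The Legendre transform\<close>

text \<open>The momentum that belongs to a velocity. As \<open>inv\<close> is a choice function,
  this is a genuine inverse only for bijective \<open>deriv H0\<close>.\<close>

definition velocity_inverse :: "(real \<Rightarrow> real) \<Rightarrow> real \<Rightarrow> real" where
  "velocity_inverse H0 = inv (deriv H0)"

text \<open>The Legendre transform with its maximiser inserted: \<open>p * v - H0 p\<close> is
  concave in \<open>p\<close>, and its derivative vanishes where
  \<open>deriv H0 p = v\<close>.\<close>

definition legendre :: "(real \<Rightarrow> real) \<Rightarrow> real \<Rightarrow> real" where
  "legendre H0 v = velocity_inverse H0 v * v - H0 (velocity_inverse H0 v)"

lemma above_tangent_of_mono_deriv:
  fixes f :: "real \<Rightarrow> real"
  assumes diff: "\<And>x. f differentiable (at x)" and mono: "mono (deriv f)"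
  shows "f x + deriv f x * (y - x) \<le> f y"
proof -
  have D: "DERIV f u :> deriv f u" for u
    using diff by (simp add: DERIV_deriv_iff_real_differentiable)
  consider "x < y" | "y < x" | "x = y" by linarith
  then show ?thesis
  proof cases
    case 1
    then obtain u where u: "x < u" "u < y" "f y - f x = (y - x) * deriv f u"
      using MVT2[of x y f "deriv f"] D by auto
    have "deriv f x * (y - x) \<le> (y - x) * deriv f u"
      using u 1 monoD[OF mono, of x u] by (simp add: mult.commute mult_left_mono)
    then show ?thesis using u by linarith
  next
    case 2
    then obtain u where u: "y < u" "u < x" "f x - f y = (x - y) * deriv f u"
      using MVT2[of y x f "deriv f"] D by auto
    have "(x - y) * deriv f u \<le> (x - y) * deriv f x"
      using u 2 monoD[OF mono, of u x] by (simp add: mult_left_mono)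
    then show ?thesis using u by (simp add: algebra_simps)
  qed simp
qed

text \<open>The tangent at \<open>p\<close>, evaluated at 0, bounds the slope
  \<open>deriv f p\<close> from below by the quotient \<open>(f p - f 0) / p\<close>, which
  superlinearity makes arbitrarily large; likewise at \<open>-p\<close> with the opposite sign. The
  intermediate value theorem fills the gap.\<close>

lemma surj_deriv_superlinear:
  fixes f :: "real \<Rightarrow> real"
  assumes diff: "\<And>x. f differentiable (at x)" and mono: "mono (deriv f)"
    and cont: "continuous_on UNIV (deriv f)"
    and super: "\<And>N. N > 0 \<Longrightarrow> \<exists>P>0. \<forall>p. \<bar>p\<bar> > P \<longrightarrow> f p > N * \<bar>p\<bar>"
  shows "surj (deriv f)"
proof -
  note tangent = above_tangent_of_mono_deriv[OF diff mono]
  have "\<exists>p. v \<le> deriv f p \<and> deriv f (-p) \<le> -v" if v: "v > 0" for v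
  proof -
    \<comment> \<open>The extra \<open>\<bar>f 0\<bar>\<close> in the growth rate absorbs the
      constant \<open>f 0\<close>, because the point \<open>p = P + 1\<close> is at least 1.\<close>
    obtain P where P: "P > 0" "\<And>p. \<bar>p\<bar> > P \<Longrightarrow> f p > (v + \<bar>f 0\<bar>) * \<bar>p\<bar>"
      using super[of "v + \<bar>f 0\<bar>"] add_pos_nonneg[OF v abs_ge_zero] by blast
    define p where "p = P + 1"
    have "f 0 \<le> \<bar>f 0\<bar> * p" using P(1) mult_left_mono[of 1 p "\<bar>f 0\<bar>"] by (simp add: p_def)
    then have "v * p + f 0 \<le> (v + \<bar>f 0\<bar>) * p" by (simp add: algebra_simps)
    then have "v * p \<le> f p - f 0" "v * p \<le> f (-p) - f 0" 
      using P(2)[of p] P(2)[of "-p"] P(1) by (simp_all add: p_def add.commute)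
    moreover have "f p - f 0 \<le> deriv f p * p" "f (-p) - f 0 \<le> - deriv f (-p) * p"
      using tangent[of p 0] tangent[of "-p" 0] by (simp_all add: algebra_simps)
    ultimately have "v * p \<le> deriv f p * p" "v * p \<le> - deriv f (-p) * p" by linarith+
    moreover have "p > 0" using P(1) by (simp add: p_def)
    ultimately have "v \<le> deriv f p" "v \<le> - deriv f (-p)" by (metis mult_le_cancel_right_pos)+
    then show ?thesis by (intro exI[of _ p]) auto
  qed
  note far = this
  show ?thesis
  proof (intro surjI)
    fix v
    obtain p where p: "\<bar>v\<bar> + 1 \<le> deriv f p" "deriv f (-p) \<le> -(\<bar>v\<bar> + 1)"
      using far[of "\<bar>v\<bar> + 1"] by (metis abs_ge_zero add_nonneg_pos zero_less_one)
    have "deriv f (-p) < deriv f p" using p by linarith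
    then have "-p \<le> p" using monoD[OF mono, of p "-p"] by linarith
    then have "\<exists>q. -p \<le> q \<and> q \<le> p \<and> deriv f q = v"
      using p cont by (intro IVT') (auto intro: continuous_on_subset)
    then show "deriv f (SOME q. deriv f q = v) = v" by (metis (mono_tags, lifting) someI)
  qed
qed

context
  fixes H0 :: "real \<Rightarrow> real"
  assumes diff: "\<And>x. H0 differentiable (at x)" and smono: "strict_mono (deriv H0)"
    and surj: "surj (deriv H0)"
begin

lemma deriv_velocity_inverse [simp]: "deriv H0 (velocity_inverse H0 v) = v"
  unfolding velocity_inverse_def using surj by (rule surj_f_inv_f)

lemma velocity_inverse_deriv [simp]: "velocity_inverse H0 (deriv H0 p) = p"
  unfolding velocity_inverse_def by (intro inv_f_f strict_mono_imp_inj_on smono)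

lemma fenchel_young: "p * v - H0 p \<le> legendre H0 v"
  using above_tangent_of_mono_deriv[OF diff strict_mono_mono[OF smono], of "velocity_inverse H0 v" p]
  unfolding legendre_def by (simp add: algebra_simps)

lemma legendre_attained: "\<exists>v. legendre H0 v = p * v - H0 p"
  by (intro exI[of _ "deriv H0 p"]) (simp add: legendre_def)

text \<open>By \<open>fenchel_young\<close> at \<open>w\<close>, the difference of the transforms at
  \<open>v\<close> and \<open>w\<close> is at most \<open>v - w\<close> times the maximising
  momentum at \<open>v\<close>. This momentum increases with \<open>v\<close>, so its values at the
  ends of the interval bound it.\<close>

lemma legendre_locally_lipschitz:
  "\<exists>C\<ge>0. \<forall>v w. \<bar>v\<bar> \<le> A \<longrightarrow> \<bar>w\<bar> \<le> A \<longrightarrow> \<bar>legendre H0 v - legendre H0 w\<bar> \<le> C * \<bar>v - w\<bar>"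
proof -
  let ?g = "velocity_inverse H0"
  have g_mono: "?g v \<le> ?g w" if "v \<le> w" for v w
    using that strict_mono_less[OF smono, of "?g w" "?g v"] by (metis deriv_velocity_inverse not_less)
  define C where "C = max \<bar>?g A\<bar> \<bar>?g (-A)\<bar>"
  have one: "legendre H0 v - legendre H0 w \<le> C * \<bar>v - w\<bar>" if "\<bar>v\<bar> \<le> A" for v w
  proof -
    have "?g (-A) \<le> ?g v" "?g v \<le> ?g A" using that by (intro g_mono; linarith)+
    then have "\<bar>?g v\<bar> \<le> C" unfolding C_def by linarith
    have "legendre H0 v - legendre H0 w \<le> ?g v * (v - w)"
      using fenchel_young[of "?g v" w] unfolding legendre_def[of H0 v] by (simp add: algebra_simps)
    also have "\<dots> \<le> \<bar>?g v\<bar> * \<bar>v - w\<bar>" by (metis abs_ge_self abs_mult)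
    also have "\<dots> \<le> C * \<bar>v - w\<bar>" using \<open>\<bar>?g v\<bar> \<le> C\<close> by (intro mult_right_mono) auto
    finally show ?thesis .
  qed
  show ?thesis
  proof (intro exI[of _ C] conjI allI impI)
    show "0 \<le> C" unfolding C_def by auto
    fix v w assume "\<bar>v\<bar> \<le> A" "\<bar>w\<bar> \<le> A"
    then show "\<bar>legendre H0 v - legendre H0 w\<bar> \<le> C * \<bar>v - w\<bar>"
      using one[of v w] one[of w v] by (simp add: abs_le_iff abs_minus_commute)
  qed
qed

end

section \<open>The discounted value function\<close>

text \<open>Chebyshev's inequality for counting measure: each index outside the set contributes more
  than \<open>2 * B\<close>, so at most half of them lie outside. It will locate the slow steps of a
  nearly optimal path.\<close>

lemma card_small_values:
  fixes f :: "nat \<Rightarrow> real" and B :: real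
  assumes "B > 0" "(\<Sum>j<N. \<bar>f j\<bar>) \<le> N * B"
  shows "N \<le> 2 * card {j \<in> {..<N}. \<bar>f j\<bar> \<le> 2 * B}"
proof -
  let ?G = "{j \<in> {..<N}. \<bar>f j\<bar> \<le> 2 * B}"
  have "(N - real (card ?G)) * (2 * B) = (\<Sum>j\<in>{..<N} - ?G. 2 * B)"
  proof -
    have sub: "?G \<subseteq> {..<N}" by auto
    then have "card ?G \<le> N" using card_mono[OF finite_lessThan sub] by simp
    then show ?thesis using sub by (simp only: sum_constant card_Diff_subset[OF finite_subset[OF sub finite_lessThan]]
      card_lessThan of_nat_diff)
  qed
  also have "\<dots> \<le> (\<Sum>j\<in>{..<N} - ?G. \<bar>f j\<bar>)" by (rule sum_mono) auto
  also have "\<dots> \<le> (\<Sum>j<N. \<bar>f j\<bar>)" by (rule sum_mono2) auto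
  also have "\<dots> \<le> N * B" by fact
  finally have "(2 * (N - real (card ?G))) * B \<le> N * B" by (simp only: mult_ac)
  then have "2 * (N - real (card ?G)) \<le> N" using assms(1) by (metis mult_le_cancel_right_pos)
  then have "real N \<le> real (2 * card ?G)" by simp
  then show ?thesis by (simp only: of_nat_le_iff)
qed

text \<open>\<open>young\<close> and \<open>dual\<close> together say that \<open>H0 p\<close> is
  the attained maximum of \<open>p * v - L v\<close>: the first serves lower bounds on costs, the
  second supplies one good velocity for upper bounds. \<open>m\<close> and \<open>M\<close> may be
  any bounds for \<open>U\<close>.\<close>

locale tonelli =
  fixes H0 L :: "real \<Rightarrow> real" and U :: "real \<times> real \<Rightarrow> real" and K m M :: real
  assumes young: "p * v - H0 p \<le> L v"
    and dual: "\<exists>v. L v = p * v - H0 p"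
    and L_lipschitz: "\<exists>C\<ge>0. \<forall>v w. \<bar>v\<bar> \<le> A \<longrightarrow> \<bar>w\<bar> \<le> A \<longrightarrow> \<bar>L v - L w\<bar> \<le> C * \<bar>v - w\<bar>"
    and H0_cont: "continuous_on UNIV H0"
    and U_lipschitz: "\<bar>U (t, x) - U (s, y)\<bar> \<le> K * (\<bar>t - s\<bar> + \<bar>x - y\<bar>)"
    and K_nonneg: "0 \<le> K"
    and U_periodic: "periodic_plane U"
    and U_lower: "m \<le> U z" and U_upper: "U z \<le> M"
begin

text \<open>Time step \<open>1 / n\<^sup>2\<close>, discount rate \<open>1 / n\<close>, speed at most \<open>n\<close>: a period consists of exactly
  \<open>n\<^sup>2\<close> steps, the space covered in one step tends to 0, and so does the ratio of step to rate, which
  bounds the oscillation in time below the scale of one step.\<close>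

definition step :: "nat \<Rightarrow> real" where "step n = 1 / (real n)\<^sup>2"

text \<open>A step of length \<open>1 / n\<^sup>2\<close> at rate \<open>1 / n\<close> discounts by
  one minus their product, the Euler form of the exponential; hence the cube.\<close>

definition disc :: "nat \<Rightarrow> real" where "disc n = 1 - 1 / real n ^ 3"

text \<open>The speed limit bounds the running cost, so that the discounted series converges; it
  grows with \<open>n\<close>, so that every fixed velocity is eventually admissible.\<close>

definition controls :: "nat \<Rightarrow> (nat \<Rightarrow> real) set" where
  "controls n = {v. \<forall>j. \<bar>v j\<bar> \<le> real n}"

text \<open>Time runs backwards: a control is the sequence of velocities met on the way from \<open>z\<close>
  into the past.\<close>

definition node :: "nat \<Rightarrow> (nat \<Rightarrow> real) \<Rightarrow> real \<times> real \<Rightarrow> nat \<Rightarrow> real \<times> real" where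
  "node n v z j = (fst z - real j * step n, snd z - step n * sum v {..<j})"

text \<open>\<open>U\<close> is taken at the later end of each step, so that the first stage sees
  \<open>U z\<close> itself.\<close>

definition stage :: "nat \<Rightarrow> real \<Rightarrow> (nat \<Rightarrow> real) \<Rightarrow> real \<times> real \<Rightarrow> nat \<Rightarrow> real" where
  "stage n a v z j = L (v j) - a * v j - U (node n v z j)"

definition cost :: "nat \<Rightarrow> real \<Rightarrow> (nat \<Rightarrow> real) \<Rightarrow> real \<times> real \<Rightarrow> real" where
  "cost n a v z = (\<Sum>j. disc n ^ j * step n * stage n a v z j)"

definition val :: "nat \<Rightarrow> real \<Rightarrow> real \<times> real \<Rightarrow> real" where
  "val n a z = (INF v\<in>controls n. cost n a v z)"

section \<open>Discount weights\<close>

lemma step_pos: "2 \<le> n \<Longrightarrow> 0 < step n"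
  by (simp add: step_def)

lemma step_square: "2 \<le> n \<Longrightarrow> real (n\<^sup>2) * step n = 1"
  by (simp add: step_def)

lemma disc_bounds: assumes "2 \<le> n" shows "0 < disc n" "disc n < 1"
proof -
  have "1 ^ 3 < real n ^ 3" using assms by (intro power_strict_mono) auto
  then show "0 < disc n" "disc n < 1" using assms by (auto simp: disc_def divide_less_eq)
qed

lemma one_minus_disc: "2 \<le> n \<Longrightarrow> 1 - disc n = step n / n"
  by (simp add: disc_def step_def power3_eq_cube power2_eq_square)

lemma disc_power_le_1: "2 \<le> n \<Longrightarrow> disc n ^ j \<le> 1"
  using disc_bounds[of n] by (simp add: power_le_one)

text \<open>Bernoulli's inequality: \<open>n\<^sup>2\<close> factors \<open>1 - 1 / n ^ 3\<close>
  lose at most \<open>1 / n\<close> in total.\<close>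

lemma disc_power_period: assumes "2 \<le> n" shows "1 - 1 / n \<le> disc n ^ n\<^sup>2"
proof -
  have "1 + real (n\<^sup>2) * (- (step n / n)) \<le> (1 + (- (step n / n))) ^ n\<^sup>2"
    using disc_bounds[OF assms] one_minus_disc[OF assms]
    by (intro Bernoulli_inequality) linarith
  moreover have "1 + (- (step n / n)) = disc n" using one_minus_disc[OF assms] by simp
  moreover have "1 + real (n\<^sup>2) * (- (step n / n)) = 1 - 1 / n"
    using step_square[OF assms] by (simp add: mult.commute)
  ultimately show ?thesis by (simp only:)
qed

text \<open>Within one period the weights are bounded below, so a discounted sum of nonnegative
  terms controls the plain one up to a factor 2.\<close>

lemma disc_power_half: assumes "2 \<le> n" "j < n\<^sup>2" shows "1 / 2 \<le> disc n ^ j"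
proof -
  have "1 / 2 \<le> 1 - 1 / real n" using assms by (simp add: field_simps)
  also have "\<dots> \<le> disc n ^ n\<^sup>2" by (rule disc_power_period[OF assms(1)])
  also have "\<dots> \<le> disc n ^ j"
    using assms disc_bounds[OF assms(1)] by (intro power_decreasing) auto
  finally show ?thesis .
qed

text \<open>The total discounted time is the inverse rate \<open>n\<close>; this is the source of
  the factor \<open>n\<close> in the bounds on \<open>cost\<close> and \<open>val\<close>.\<close>

lemma weights_sums: assumes "2 \<le> n" shows "(\<lambda>j. disc n ^ j * step n * c) sums (n * c)"
proof -
  have "(\<lambda>j. disc n ^ j) sums (1 / (1 - disc n))"
    using disc_bounds[OF assms] by (intro geometric_sums) auto
  from sums_mult2[OF this, of "step n * c"] show ?thesis
    using step_pos[OF assms] unfolding one_minus_disc[OF assms] by (simp add: mult.assoc)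
qed

lemma sum_weights_le:
  assumes "2 \<le> n" "0 \<le> c" shows "(\<Sum>j<n\<^sup>2. disc n ^ j * step n * c) \<le> c"
proof -
  have "(\<Sum>j<n\<^sup>2. disc n ^ j * step n * c) \<le> (\<Sum>j<n\<^sup>2. 1 * step n * c)"
    using assms disc_power_le_1 step_pos[OF assms(1)] by (intro sum_mono mult_right_mono) auto
  also have "\<dots> = c" using step_square[OF assms(1)] by simp
  finally show ?thesis .
qed

lemma controls_bound: "v \<in> controls n \<Longrightarrow> \<bar>v j\<bar> \<le> n"
  by (simp add: controls_def)

lemma controls_shift: "v \<in> controls n \<Longrightarrow> (\<lambda>i. v (i + k)) \<in> controls n"
  by (simp add: controls_def)

lemma zero_in_controls: "(\<lambda>_. 0) \<in> controls n"
  by (simp add: controls_def)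

lemma stage_bounded: "\<exists>S. \<forall>v\<in>controls n. \<forall>z j. \<bar>stage n a v z j\<bar> \<le> S"
proof -
  obtain C where C: "C \<ge> 0" "\<And>v w. \<bar>v\<bar> \<le> real n \<Longrightarrow> \<bar>w\<bar> \<le> real n \<Longrightarrow> \<bar>L v - L w\<bar> \<le> C * \<bar>v - w\<bar>"
    using L_lipschitz[of "real n"] by blast
  show ?thesis
  proof (intro exI[of _ "\<bar>L 0\<bar> + C * n + \<bar>a\<bar> * n + \<bar>m\<bar> + \<bar>M\<bar>"] ballI allI)
    fix v z j assume v: "v \<in> controls n"
    note vj = controls_bound[OF v, of j]
    have "\<bar>L (v j) - L 0\<bar> \<le> C * \<bar>v j - 0\<bar>" using C(2)[of "v j" 0] vj by simp
    moreover have "C * \<bar>v j\<bar> \<le> C * n" using vj C(1) by (rule mult_left_mono)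
    moreover have "\<bar>a * v j\<bar> \<le> \<bar>a\<bar> * n" unfolding abs_mult by (rule mult_left_mono[OF vj]) simp
    ultimately show "\<bar>stage n a v z j\<bar> \<le> \<bar>L 0\<bar> + C * n + \<bar>a\<bar> * n + \<bar>m\<bar> + \<bar>M\<bar>"
      using U_lower[of "node n v z j"] U_upper[of "node n v z j"]
      unfolding stage_def diff_0_right by linarith
  qed
qed

lemma cost_summable:
  assumes n: "2 \<le> n" and v: "v \<in> controls n"
  shows "summable (\<lambda>j. disc n ^ j * step n * stage n a v z j)"
proof -
  obtain S where S: "\<And>j. \<bar>stage n a v z j\<bar> \<le> S" using stage_bounded v by blast
  show ?thesis
  proof (rule summable_comparison_test')
    show "summable (\<lambda>j. disc n ^ j * step n * S)" using weights_sums[OF n] by (rule sums_summable)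
    show "norm (disc n ^ j * step n * stage n a v z j) \<le> disc n ^ j * step n * S" for j
      using S[of j] disc_bounds[OF n] step_pos[OF n]
      by (simp add: abs_mult mult_left_mono)
  qed
qed

lemma cost_mono:
  assumes n: "2 \<le> n" and v: "v \<in> controls n" and w: "w \<in> controls n"
    and le: "\<And>j. stage n a v z j \<le> stage n b w z' j + c"
  shows "cost n a v z \<le> cost n b w z' + n * c"
proof -
  have "cost n a v z \<le> (\<Sum>j. disc n ^ j * step n * stage n b w z' j + disc n ^ j * step n * c)"
    unfolding cost_def
  proof (rule suminf_le)
    show "disc n ^ j * step n * stage n a v z j
        \<le> disc n ^ j * step n * stage n b w z' j + disc n ^ j * step n * c" for j
      using le[of j] disc_bounds[OF n] step_pos[OF n]
      unfolding distrib_left[symmetric] by (intro mult_left_mono) auto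
  qed (intro cost_summable summable_add sums_summable[OF weights_sums] n v w)+
  also have "\<dots> = cost n b w z' + n * c"
    unfolding cost_def
    by (subst suminf_add[symmetric])
       (simp_all add: cost_summable n w sums_summable[OF weights_sums] sums_unique[OF weights_sums, symmetric])
  finally show ?thesis .
qed

lemma cost_ge:
  assumes n: "2 \<le> n" and v: "v \<in> controls n" and le: "\<And>j. c \<le> stage n a v z j"
  shows "n * c \<le> cost n a v z"
  unfolding cost_def sums_unique[OF weights_sums[OF n]]
  using le disc_bounds[OF n] step_pos[OF n]
  by (intro suminf_le cost_summable sums_summable[OF weights_sums] n v mult_left_mono) auto

lemma cost_le:
  assumes n: "2 \<le> n" and v: "v \<in> controls n" and le: "\<And>j. stage n a v z j \<le> c"
  shows "cost n a v z \<le> n * c"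
  unfolding cost_def sums_unique[OF weights_sums[OF n]]
  using le disc_bounds[OF n] step_pos[OF n]
  by (intro suminf_le cost_summable sums_summable[OF weights_sums] n v mult_left_mono) auto

section \<open>A priori bounds on the value function\<close>

lemma stage_ge: "- H0 a - M \<le> stage n a v z j"
  using young[of a "v j"] U_upper[of "node n v z j"] unfolding stage_def by linarith

lemma cost_lower: "2 \<le> n \<Longrightarrow> v \<in> controls n \<Longrightarrow> n * (- H0 a - M) \<le> cost n a v z"
  using stage_ge by (intro cost_ge) auto

lemma val_le_cost: "2 \<le> n \<Longrightarrow> v \<in> controls n \<Longrightarrow> val n a z \<le> cost n a v z"
  unfolding val_def by (intro cINF_lower bdd_belowI2[of _ "n * (- H0 a - M)"] cost_lower)

lemma val_greatest: "(\<And>v. v \<in> controls n \<Longrightarrow> c \<le> cost n a v z) \<Longrightarrow> c \<le> val n a z"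
  unfolding val_def by (intro cINF_greatest) (use zero_in_controls in auto)

lemma val_almost_attained:
  assumes "2 \<le> n" "0 < \<epsilon>" shows "\<exists>v\<in>controls n. cost n a v z < val n a z + \<epsilon>"
proof (rule ccontr)
  assume "\<not> ?thesis"
  then have "val n a z + \<epsilon> \<le> val n a z" by (intro val_greatest) auto
  then show False using assms by simp
qed

lemma val_lower: "2 \<le> n \<Longrightarrow> n * (- H0 a - M) \<le> val n a z"
  by (intro val_greatest cost_lower)

text \<open>The constant velocity at which Young's inequality for the slope \<open>a\<close> is an
  equality has running cost \<open>- H0 a - U\<close>. It is admissible only once \<open>n\<close>
  reaches its modulus, whence \<open>n0\<close>.\<close>

lemma val_upper: "\<exists>n0\<ge>2. \<forall>n\<ge>n0. \<forall>z. val n a z \<le> n * (- H0 a - m)"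
proof -
  obtain v where v: "L v = a * v - H0 a" using dual by blast
  show ?thesis
  proof (intro exI[of _ "max 2 (nat \<lceil>\<bar>v\<bar>\<rceil>)"] conjI allI impI)
    fix n z assume "max 2 (nat \<lceil>\<bar>v\<bar>\<rceil>) \<le> n"
    then have n: "2 \<le> n" and c: "(\<lambda>_. v) \<in> controls n"
      by (auto simp: controls_def nat_le_iff ceiling_le_iff)
    have "cost n a (\<lambda>_. v) z \<le> n * (- H0 a - m)"
      using v U_lower by (intro cost_le[OF n c]) (simp add: stage_def)
    with val_le_cost[OF n c] show "val n a z \<le> n * (- H0 a - m)" by (rule order.trans)
  qed simp
qed

lemma val_abs_le: "\<exists>n0\<ge>2. \<exists>C\<ge>0. \<forall>n\<ge>n0. \<forall>z. \<bar>val n a z\<bar> \<le> real n * C"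
proof -
  obtain n0 where n0: "n0 \<ge> 2" "\<And>n z. n \<ge> n0 \<Longrightarrow> val n a z \<le> n * (- H0 a - m)"
    using val_upper by blast
  define C where "C = \<bar>H0 a\<bar> + \<bar>m\<bar> + \<bar>M\<bar>"
  have "\<bar>val n a z\<bar> \<le> n * C" if "n \<ge> n0" for n z
  proof -
    have "n * (- H0 a - m) \<le> n * C" "n * (- C) \<le> n * (- H0 a - M)"
      unfolding C_def by (intro mult_left_mono; linarith)+
    then have "val n a z \<le> n * C" "n * (- C) \<le> val n a z"
      using n0(2)[OF that, of z] val_lower[of n a z] n0(1) that by linarith+
    then show ?thesis by (simp add: abs_le_iff)
  qed
  moreover have "C \<ge> 0" by (simp add: C_def)
  ultimately show ?thesis using n0(1) by blast
qed

lemma val_concave: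
  assumes n: "2 \<le> n" and \<theta>: "0 \<le> \<theta>" "\<theta> \<le> 1"
  shows "(1 - \<theta>) * val n a z + \<theta> * val n b z \<le> val n ((1 - \<theta>) * a + \<theta> * b) z"
proof (rule val_greatest)
  fix v assume v: "v \<in> controls n"
  have "cost n ((1 - \<theta>) * a + \<theta> * b) v z = 
      (\<Sum>j. (1 - \<theta>) * (disc n ^ j * step n * stage n a v z j) + \<theta> * (disc n ^ j * step n * stage n b v z j))"
    unfolding cost_def stage_def by (intro suminf_cong) (simp add: algebra_simps)
  also have "\<dots> = (1 - \<theta>) * cost n a v z + \<theta> * cost n b v z"
    unfolding cost_def
    using suminf_add[OF summable_mult[OF cost_summable[OF n v]] summable_mult[OF cost_summable[OF n v]], 
      of "1 - \<theta>" a z \<theta> b z]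
    by (simp add: suminf_mult cost_summable n v)
  finally show "(1 - \<theta>) * val n a z + \<theta> * val n b z \<le> cost n ((1 - \<theta>) * a + \<theta> * b) v z"
    using \<theta> val_le_cost[OF n v] by (simp add: add_mono mult_left_mono)
qed

lemma val_shift_mono:
  assumes n: "2 \<le> n" and le: "\<And>v j. v \<in> controls n \<Longrightarrow> stage n a v z j \<le> stage n a v z' j + c"
  shows "val n a z \<le> val n a z' + n * c"
proof -
  have "val n a z - n * c \<le> val n a z'"
  proof (rule val_greatest)
    fix v assume v: "v \<in> controls n"
    show "val n a z - n * c \<le> cost n a v z'"
      using val_le_cost[OF n v, of a z] cost_mono[OF n v v le[OF v]] by simp
  qed
  then show ?thesis by simp
qed

lemma val_periodic: assumes n: "2 \<le> n" shows "periodic_plane (val n a)"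
proof -
  have U1: "U (t + 1 - c, x) = U (t - c, x)" "U (t, x + 1 - c) = U (t, x - c)" for t x c
    using U_periodic[unfolded periodic_plane_def, rule_format, of "t - c" x]
      U_periodic[unfolded periodic_plane_def, rule_format, of t "x - c"]
    by (simp_all add: algebra_simps)
  have "stage n a v (t + 1, x) j = stage n a v (t, x) j"
       "stage n a v (t, x + 1) j = stage n a v (t, x) j" for v t x j
    by (simp_all add: stage_def node_def U1)
  then show ?thesis by (simp add: periodic_plane_def val_def cost_def)
qed

text \<open>The constant \<open>n * K\<close> blows up. It serves only for time differences of at
  most one step, where it yields the error \<open>K / n\<close>.\<close>

lemma val_lipschitz_time:
  assumes n: "2 \<le> n" shows "val n a (t, x) \<le> val n a (s, x) + n * (K * \<bar>t - s\<bar>)"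
proof (rule val_shift_mono[OF n])
  fix v j
  show "stage n a v (t, x) j \<le> stage n a v (s, x) j + K * \<bar>t - s\<bar>"
    using U_lipschitz[of "t - j * step n" "x - step n * sum v {..<j}" 
      "s - j * step n" "x - step n * sum v {..<j}"]
    unfolding stage_def node_def by simp
qed

section \<open>Dynamic programming\<close>

lemma node_shift: "node n (\<lambda>i. v (i + k)) (node n v z k) j = node n v z (j + k)"
proof -
  have "sum v {..<j + k} = sum v {..<k} + (\<Sum>i<j. v (i + k))" by (induction j) auto
  then show ?thesis by (simp add: node_def algebra_simps)
qed

lemma cost_split:
  assumes n: "2 \<le> n" and v: "v \<in> controls n"
  shows "cost n a v z = (\<Sum>j<k. disc n ^ j * step n * stage n a v z j)
    + disc n ^ k * cost n a (\<lambda>i. v (i + k)) (node n v z k)"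
proof -
  have "stage n a (\<lambda>i. v (i + k)) (node n v z k) j = stage n a v z (j + k)" for j
    by (simp add: stage_def node_shift)
  then have "disc n ^ k * cost n a (\<lambda>i. v (i + k)) (node n v z k)
      = (\<Sum>j. disc n ^ k * (disc n ^ j * step n * stage n a v z (j + k)))"
    unfolding cost_def using cost_summable[OF n controls_shift[OF v], of a k "node n v z k"]
    by (simp add: suminf_mult)
  also have "\<dots> = (\<Sum>j. disc n ^ (j + k) * step n * stage n a v z (j + k))"
    by (simp add: power_add mult_ac)
  finally show ?thesis
    unfolding cost_def[of n a v z] using suminf_split_initial_segment[OF cost_summable[OF n v], of a z k]
    by linarith
qed

text \<open>The first \<open>k\<close> velocities of \<open>v\<close> followed by an arbitrary
  control form a control again; minimising over the continuation gives the value at the node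
  reached.\<close>

lemma dynamic_programming_le:
  assumes n: "2 \<le> n" and v: "v \<in> controls n"
  shows "val n a z \<le> (\<Sum>j<k. disc n ^ j * step n * stage n a v z j) + disc n ^ k * val n a (node n v z k)"
proof -
  let ?S = "\<Sum>j<k. disc n ^ j * step n * stage n a v z j"
  have "(val n a z - ?S) / disc n ^ k \<le> val n a (node n v z k)"
  proof (rule val_greatest)
    fix w assume w: "w \<in> controls n"
    define u where "u i = (if i < k then v i else w (i - k))" for i
    have u: "u \<in> controls n" using v w by (simp add: controls_def u_def)
    have "sum u {..<j} = sum v {..<j}" if "j \<le> k" for j
      using that by (intro sum.cong) (auto simp: u_def)
    then have node_eq: "node n u z j = node n v z j" if "j \<le> k" for j
      using that by (simp add: node_def)
    then have "(\<Sum>j<k. disc n ^ j * step n * stage n a u z j) = ?S"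
      by (intro sum.cong) (auto simp: stage_def u_def)
    moreover have "(\<lambda>i. u (i + k)) = w" by (simp add: u_def)
    ultimately have "cost n a u z = ?S + disc n ^ k * cost n a w (node n v z k)"
      using cost_split[OF n u, of a z k] node_eq[of k] by simp
    then have "val n a z - ?S \<le> cost n a w (node n v z k) * disc n ^ k"
      using val_le_cost[OF n u, of a z] by (simp add: mult.commute)
    then show "(val n a z - ?S) / disc n ^ k \<le> cost n a w (node n v z k)"
      using disc_bounds[OF n] by (simp add: pos_divide_le_eq)
  qed
  then have "val n a z - ?S \<le> val n a (node n v z k) * disc n ^ k"
    using disc_bounds[OF n] by (simp add: pos_divide_le_eq)
  then show ?thesis by (simp add: mult.commute)
qed

lemma dynamic_programming_ge:
  assumes n: "2 \<le> n" and \<epsilon>: "0 < \<epsilon>"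
  shows "\<exists>v\<in>controls n. (\<Sum>j<k. disc n ^ j * step n * stage n a v z j)
    + disc n ^ k * val n a (node n v z k) \<le> val n a z + \<epsilon>"
proof -
  obtain v where v: "v \<in> controls n" and lt: "cost n a v z < val n a z + \<epsilon>"
    using val_almost_attained[OF n \<epsilon>] by blast
  have "disc n ^ k * val n a (node n v z k) \<le> disc n ^ k * cost n a (\<lambda>i. v (i + k)) (node n v z k)"
    using val_le_cost[OF n controls_shift[OF v]] disc_bounds[OF n] by (intro mult_left_mono) auto
  then show ?thesis using lt v unfolding cost_split[OF n v, of a z k] by force
qed

subsection \<open>Uniform Lipschitz estimates\<close>

text \<open>Young's inequality at the slopes \<open>a + A\<close> and \<open>a - A\<close>, the
  choice depending on the sign of \<open>v\<close>.\<close>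

lemma coercive: assumes "0 \<le> A" shows "\<exists>C\<ge>0. \<forall>v. A * \<bar>v\<bar> - C \<le> L v - a * v"
proof (intro exI[of _ "\<bar>H0 (a + A)\<bar> + \<bar>H0 (a - A)\<bar>"] conjI allI)
  fix v
  show "A * \<bar>v\<bar> - (\<bar>H0 (a + A)\<bar> + \<bar>H0 (a - A)\<bar>) \<le> L v - a * v"
    using young[of "a + A" v] young[of "a - A" v] by (cases "v \<ge> 0") (simp_all add: algebra_simps)
qed simp

text \<open>The value is of order \<open>n\<close> and one period of discounting loses a fraction of
  at most \<open>1 / n\<close>, so only a bounded error remains.\<close>

lemma disc_period_val:
  assumes n: "2 \<le> n" and C: "\<bar>val n a z\<bar> \<le> real n * C"
  shows "\<bar>disc n ^ n\<^sup>2 * val n a z - val n a z\<bar> \<le> C"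
proof -
  have "\<bar>disc n ^ n\<^sup>2 * val n a z - val n a z\<bar> = (1 - disc n ^ n\<^sup>2) * \<bar>val n a z\<bar>"
  proof -
    have "disc n ^ n\<^sup>2 * val n a z - val n a z = - ((1 - disc n ^ n\<^sup>2) * val n a z)"
      by (simp add: algebra_simps)
    then show ?thesis using disc_power_le_1[OF n, of "n\<^sup>2"] by (simp add: abs_mult)
  qed
  also have "\<dots> \<le> (1 / n) * (n * C)"
    using disc_power_period[OF n] C by (intro mult_mono) auto
  also have "\<dots> = C" using n by simp
  finally show ?thesis .
qed

lemma val_time_period: "2 \<le> n \<Longrightarrow> val n a (t - 1, x) = val n a (t, x)"
  using val_periodic[of n a, unfolded periodic_plane_def, rule_format, of "t - 1" x] by simp

lemma node_period: "2 \<le> n \<Longrightarrow> node n v (t, x) (n\<^sup>2) = (t - 1, x - step n * sum v {..<n\<^sup>2})"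
  using step_square[of n] by (simp add: node_def)

text \<open>A straight path covers the distance from \<open>x\<close> to \<open>y\<close>, at most 1
  after an integer shift, within one period of time; it ends at \<open>(t - 1, y)\<close>, where the
  value is that at \<open>(t, y)\<close>. Action and discount error are bounded independently of
  \<open>n\<close>.\<close>

lemma val_oscillation:
  "\<exists>n0\<ge>2. \<exists>C\<ge>0. \<forall>n\<ge>n0. \<forall>t x y. val n a (t, x) \<le> val n a (t, y) + C"
proof -
  obtain n0 C0 where n0: "n0 \<ge> 2" "C0 \<ge> 0" "\<And>n z. n \<ge> n0 \<Longrightarrow> \<bar>val n a z\<bar> \<le> real n * C0"
    using val_abs_le[of a] by metis
  obtain Cl where Cl: "Cl \<ge> 0" "\<And>v w. \<bar>v\<bar> \<le> 1 \<Longrightarrow> \<bar>w\<bar> \<le> 1 \<Longrightarrow> \<bar>L v - L w\<bar> \<le> Cl * \<bar>v - w\<bar>"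
    using L_lipschitz[of 1] by blast
  define C1 where "C1 = \<bar>L 0\<bar> + Cl + \<bar>a\<bar> + \<bar>m\<bar>"
  have C1: "C1 \<ge> 0" unfolding C1_def using Cl by simp
  have near: "val n a (t, x) \<le> val n a (t, y) + (C1 + C0)" if n: "n0 \<le> n" and xy: "\<bar>x - y\<bar> \<le> 1" for n t x y
  proof -
    have n2: "2 \<le> n" using n n0 by simp
    let ?v = "\<lambda>_ :: nat. x - y"
    have v: "?v \<in> controls n" using xy n2 by (simp add: controls_def)
    have stage_le: "stage n a ?v (t, x) j \<le> C1" for j
    proof -
      have "\<bar>L (x - y) - L 0\<bar> \<le> Cl * \<bar>x - y\<bar>" using Cl(2)[of "x - y" 0] xy by simp
      moreover have "Cl * \<bar>x - y\<bar> \<le> Cl * 1" using xy Cl(1) by (rule mult_left_mono)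
      moreover have "\<bar>a * (x - y)\<bar> \<le> \<bar>a\<bar> * 1" unfolding abs_mult by (rule mult_left_mono[OF xy]) simp
      ultimately show ?thesis
        using U_lower[of "node n ?v (t, x) j"] unfolding stage_def C1_def by linarith
    qed
    have "val n a (t, x) \<le> (\<Sum>j<n\<^sup>2. disc n ^ j * step n * stage n a ?v (t, x) j)
        + disc n ^ n\<^sup>2 * val n a (node n ?v (t, x) (n\<^sup>2))"
      by (rule dynamic_programming_le[OF n2 v])
    also have "node n ?v (t, x) (n\<^sup>2) = (t - 1, y)"
    proof -
      have "step n * (real (n\<^sup>2) * (x - y)) = x - y"
        using step_square[OF n2] by (simp only: mult.assoc[symmetric] mult.commute[of "step n"] mult_1_left)
      then show ?thesis unfolding node_period[OF n2] sum_constant card_lessThan by (simp only:) simp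
    qed
    also have "(\<Sum>j<n\<^sup>2. disc n ^ j * step n * stage n a ?v (t, x) j) \<le> (\<Sum>j<n\<^sup>2. disc n ^ j * step n * C1)"
      using stage_le disc_bounds[OF n2] step_pos[OF n2] by (intro sum_mono mult_left_mono) auto
    also have "\<dots> \<le> C1" by (rule sum_weights_le[OF n2 C1])
    also have "disc n ^ n\<^sup>2 * val n a (t - 1, y) \<le> val n a (t, y) + C0"
      using disc_period_val[OF n2 n0(3)[OF n], of "(t, y)"] by (simp add: val_time_period n2 abs_le_iff)
    finally show ?thesis by simp
  qed
  have "val n a (t, x) \<le> val n a (t, y) + (C1 + C0)" if n: "n0 \<le> n" for n t x y
  proof -
    have "\<bar>x - (y + of_int \<lfloor>x - y\<rfloor>)\<bar> \<le> 1" by linarith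
    from near[OF n this, of t] show ?thesis
      using periodic_plane_of_int[OF val_periodic[of n a], of t 0 y "\<lfloor>x - y\<rfloor>"] n n0(1) by simp
  qed
  moreover have "0 \<le> C1 + C0" using C1 n0(2) by simp
  ultimately show ?thesis using n0(1) by blast
qed

text \<open>No Euler--Lagrange equation is needed: the action bound forces at least half of the steps of
  a nearly optimal path to have bounded velocity, and the displacement is spread over
  those steps only.\<close>

lemma val_lipschitz_space:
  "\<exists>n0\<ge>2. \<exists>C\<ge>0. \<forall>n\<ge>n0. \<forall>t x y. val n a (t, x) \<le> val n a (t, y) + C * \<bar>x - y\<bar>"
proof -
  obtain n1 C0 where n1: "n1 \<ge> 2" "C0 \<ge> 0" "\<And>n z. n \<ge> n1 \<Longrightarrow> \<bar>val n a z\<bar> \<le> real n * C0"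
    using val_abs_le[of a] by metis
  obtain n2 Co where n2: "n2 \<ge> 2" "Co \<ge> 0" "\<And>n t x y. n \<ge> n2 \<Longrightarrow> val n a (t, x) \<le> val n a (t, y) + Co"
    using val_oscillation[of a] by metis
  obtain C2 where C2: "C2 \<ge> 0" "\<And>v. 1 * \<bar>v\<bar> - C2 \<le> L v - a * v" using coercive[of 1] by auto
  \<comment> \<open>Twice the bound found below for the discounted mean speed: the action is at most
    \<open>Co + C0 + 1\<close>, and \<open>C2 + \<bar>M\<bar>\<close> makes up for coercivity and
    potential. The factor 2 undoes the discount.\<close>
  define B where "B = 2 * (Co + C0 + 1 + (C2 + \<bar>M\<bar>))"
  have B: "B > 0" using n1 n2 C2 unfolding B_def by simp
  \<comment> \<open>Slow steps have speed at most \<open>2 * B\<close> and will be changed by at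
    most 2.\<close>
  obtain CL where CL: "CL \<ge> 0"
    "\<And>v w. \<bar>v\<bar> \<le> 2 * B + 2 \<Longrightarrow> \<bar>w\<bar> \<le> 2 * B + 2 \<Longrightarrow> \<bar>L v - L w\<bar> \<le> CL * \<bar>v - w\<bar>"
    using L_lipschitz[of "2 * B + 2"] by blast
  define C4 where "C4 = 2 * CL + 2 * \<bar>a\<bar> + K"
  have C4: "C4 \<ge> 0" using CL(1) K_nonneg by (simp add: C4_def)
  \<comment> \<open>The last entry makes the modified velocities obey the speed limit
    \<open>n\<close>.\<close>
  define n0 where "n0 = max (max n1 n2) (nat \<lceil>2 * B + 2\<rceil>)"
  have near: "val n a (t, x) \<le> val n a (t, y) + C4 * \<bar>x - y\<bar>" if n: "n0 \<le> n" and xy: "\<bar>x - y\<bar> \<le> 1" for n t x y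
  proof (rule field_le_epsilon)
    fix \<epsilon>' :: real assume "\<epsilon>' > 0"
    \<comment> \<open>The cap at 1 keeps the action bound, and with it all constants, independent of
      the tolerance.\<close>
    define \<epsilon> where "\<epsilon> = min \<epsilon>' 1"
    have \<epsilon>: "0 < \<epsilon>" "\<epsilon> \<le> 1" "\<epsilon> \<le> \<epsilon>'" using \<open>\<epsilon>' > 0\<close> by (auto simp: \<epsilon>_def)
    have nn: "n1 \<le> n" "n2 \<le> n" "2 \<le> n" "2 * B + 2 \<le> n"
    proof -
      show "n1 \<le> n" "n2 \<le> n" "2 \<le> n" using n n1(1) unfolding n0_def by auto
      have "nat \<lceil>2 * B + 2\<rceil> \<le> n" using n unfolding n0_def by simp
      then show "2 * B + 2 \<le> n" using real_nat_ceiling_ge[of "2 * B + 2"] by linarith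
    qed
    note n' = nn(3)
    have w_pos: "0 \<le> disc n ^ j * step n" for j using disc_bounds[OF n'] step_pos[OF n'] by simp
    let ?N = "n\<^sup>2" and ?h = "x - y"
    have N: "step n * ?N = 1" using step_square[OF n'] by (simp add: mult.commute)
    obtain v where v: "v \<in> controls n" and opt: "(\<Sum>j<?N. disc n ^ j * step n * stage n a v (t, y) j)
        + disc n ^ ?N * val n a (node n v (t, y) ?N) \<le> val n a (t, y) + \<epsilon>"
      using dynamic_programming_ge[OF n' \<epsilon>(1)] by blast
    obtain X where X: "node n v (t, y) ?N = (t - 1, X)" using node_period[OF n'] by blast
    \<comment> \<open>The discounted value at the end of the path is lower than the initial one by
      at most discount error plus oscillation. As \<open>v\<close> is nearly optimal, its action
      over the period is therefore bounded.\<close>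
    have "val n a (t, y) \<le> disc n ^ ?N * val n a (node n v (t, y) ?N) + C0 + Co"
      using disc_period_val[OF n' n1(3)[OF nn(1)], of "(t, X)"] n2(3)[OF nn(2), of t y X]
      unfolding X val_time_period[OF n'] by linarith
    then have action: "(\<Sum>j<?N. disc n ^ j * step n * stage n a v (t, y) j) \<le> Co + C0 + 1"
      using opt \<epsilon>(2) by linarith
    have "(step n / 2) * (\<Sum>j<?N. \<bar>v j\<bar>) \<le> (\<Sum>j<?N. disc n ^ j * step n * \<bar>v j\<bar>)"
      unfolding sum_distrib_left
    proof (rule sum_mono)
      fix j assume "j \<in> {..<?N}"
      then have "step n / 2 \<le> disc n ^ j * step n"
        using mult_right_mono[OF disc_power_half[OF n', of j], of "step n"] step_pos[OF n'] by simp
      then show "step n / 2 * \<bar>v j\<bar> \<le> disc n ^ j * step n * \<bar>v j\<bar>" by (rule mult_right_mono) simp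
    qed
    also have "\<dots> \<le> (\<Sum>j<?N. disc n ^ j * step n * (stage n a v (t, y) j + (C2 + \<bar>M\<bar>)))"
    proof (intro sum_mono mult_left_mono w_pos)
      fix j show "\<bar>v j\<bar> \<le> stage n a v (t, y) j + (C2 + \<bar>M\<bar>)"
        using C2(2)[of "v j"] U_upper[of "node n v (t, y) j"] unfolding stage_def by linarith
    qed
    also have "\<dots> = (\<Sum>j<?N. disc n ^ j * step n * stage n a v (t, y) j)
        + (\<Sum>j<?N. disc n ^ j * step n * (C2 + \<bar>M\<bar>))"
      by (simp add: distrib_left sum.distrib)
    also have "\<dots> \<le> (Co + C0 + 1) + (C2 + \<bar>M\<bar>)"
      using C2(1) by (intro add_mono action sum_weights_le n') auto
    finally have "step n * (\<Sum>j<?N. \<bar>v j\<bar>) \<le> step n * (?N * B)"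
      using N unfolding B_def mult.assoc[symmetric] by simp
    then have "(\<Sum>j<?N. \<bar>v j\<bar>) \<le> ?N * B" using step_pos[OF n'] by simp
    define G where "G = {j \<in> {..<?N}. \<bar>v j\<bar> \<le> 2 * B}"
    have "?N \<le> 2 * card G" unfolding G_def by (rule card_small_values[OF B]) fact
    then have NG: "real ?N \<le> 2 * card G" by linarith
    moreover have "real ?N > 0" using n' by simp
    ultimately have cardG: "real (card G) > 0" by linarith
    \<comment> \<open>Changing the velocity by \<open>\<delta>\<close> on the steps in
      \<open>G\<close> alone displaces the path by exactly \<open>?h\<close> within the period, so
      the path from \<open>x\<close> ends where the one from \<open>y\<close> does. As
      \<open>G\<close> contains at least half of the steps, \<open>\<delta>\<close> is at most
      \<open>2 * \<bar>?h\<bar>\<close> in modulus.\<close>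
    define \<delta> where "\<delta> = ?N * ?h / card G"
    have \<delta>: "\<bar>\<delta>\<bar> \<le> 2 * \<bar>?h\<bar>"
      using mult_right_mono[OF NG, of "\<bar>?h\<bar>"] cardG unfolding \<delta>_def
      by (simp add: abs_mult divide_le_eq mult_ac)
    have \<delta>2: "\<bar>\<delta>\<bar> \<le> 2" by (rule order.trans[OF \<delta>]) (use xy in simp)
    have step_\<delta>: "step n * (card G * \<delta>) = ?h"
      using cardG N unfolding \<delta>_def by (simp add: mult.assoc[symmetric])
    define u where "u j = (if j \<in> G then v j + \<delta> else v j)" for j
    have u: "u \<in> controls n"
      unfolding controls_def
    proof safe
      fix j show "\<bar>u j\<bar> \<le> n"
      proof (cases "j \<in> G")
        case True
        then have "u j = v j + \<delta>" "\<bar>v j\<bar> \<le> 2 * B" by (auto simp: u_def G_def)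
        moreover have "\<bar>v j + \<delta>\<bar> \<le> \<bar>v j\<bar> + \<bar>\<delta>\<bar>" by (rule abs_triangle_ineq)
        ultimately show ?thesis using nn(4) \<delta>2 by simp
      qed (use controls_bound[OF v, of j] in \<open>simp add: u_def\<close>)
    qed
    have sum_u: "sum u {..<j} = sum v {..<j} + card (G \<inter> {..<j}) * \<delta>" for j
    proof -
      have "sum u {..<j} = (\<Sum>i<j. v i + (if i \<in> G then \<delta> else 0))"
        by (intro sum.cong) (auto simp: u_def)
      also have "\<dots> = sum v {..<j} + (\<Sum>i<j. if i \<in> G then \<delta> else 0)"
        by (rule sum.distrib)
      also have "(\<Sum>i<j. if i \<in> G then \<delta> else 0) = card (G \<inter> {..<j}) * \<delta>"
        by (simp add: sum.If_cases Int_commute)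
      finally show ?thesis .
    qed
    have "G \<inter> {..<?N} = G" unfolding G_def by auto
    then have end_eq: "node n u (t, x) ?N = node n v (t, y) ?N"
      using step_\<delta> sum_u[of ?N] unfolding node_period[OF n'] by (simp add: distrib_left)
    \<comment> \<open>Before step \<open>j\<close> the fraction
      \<open>card (G \<inter> {..<j}) / card G\<close> of the gap \<open>?h\<close> has been closed,
      so the two paths are never further apart than at the start.\<close>
    have stage_le: "stage n a u (t, x) j \<le> stage n a v (t, y) j + C4 * \<bar>?h\<bar>" for j
    proof -
      have "real (card (G \<inter> {..<j})) \<le> card G"
        by (intro of_nat_mono card_mono) (auto simp: G_def)
      then have "0 \<le> card (G \<inter> {..<j}) / card G \<and> card (G \<inter> {..<j}) / card G \<le> 1"
        using cardG by simp
      then have "\<bar>?h * (1 - card (G \<inter> {..<j}) / card G)\<bar> \<le> \<bar>?h\<bar>"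
        unfolding abs_mult by (intro mult_right_le_one_le) auto
      moreover have "?h * (1 - card (G \<inter> {..<j}) / card G) = ?h - step n * (card (G \<inter> {..<j}) * \<delta>)"
      proof -
        have "step n * (card (G \<inter> {..<j}) * \<delta>) = (step n * ?N) * (?h * (card (G \<inter> {..<j}) / card G))"
          unfolding \<delta>_def by simp
        then show ?thesis unfolding N by (simp add: right_diff_distrib)
      qed
      ultimately have "\<bar>?h - step n * (card (G \<inter> {..<j}) * \<delta>)\<bar> \<le> \<bar>?h\<bar>" by simp
      then have "K * \<bar>(x - step n * sum u {..<j}) - (y - step n * sum v {..<j})\<bar> \<le> K * \<bar>?h\<bar>"
        using K_nonneg unfolding sum_u by (intro mult_left_mono) (simp_all add: algebra_simps)
      then have "\<bar>U (node n u (t, x) j) - U (node n v (t, y) j)\<bar> \<le> K * \<bar>?h\<bar>"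
        using U_lipschitz[of "t - j * step n" "x - step n * sum u {..<j}"
            "t - j * step n" "y - step n * sum v {..<j}"]
        unfolding node_def by simp
      moreover have "\<bar>L (u j) - L (v j)\<bar> \<le> CL * (2 * \<bar>?h\<bar>) \<and> \<bar>a * (u j - v j)\<bar> \<le> \<bar>a\<bar> * (2 * \<bar>?h\<bar>)"
      proof (cases "j \<in> G")
        case True
        then have uj: "u j = v j + \<delta>" "\<bar>v j\<bar> \<le> 2 * B" by (auto simp: u_def G_def)
        have "\<bar>L (u j) - L (v j)\<bar> \<le> CL * \<bar>u j - v j\<bar>"
          using uj \<delta>2 abs_triangle_ineq[of "v j" \<delta>] by (intro CL(2)) auto
        also have "\<dots> \<le> CL * (2 * \<bar>?h\<bar>)" using uj \<delta> CL(1) by (intro mult_left_mono) auto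
        finally show ?thesis using uj \<delta> unfolding abs_mult by (auto intro: mult_left_mono)
      qed (use CL(1) in \<open>simp add: u_def\<close>)
      ultimately have "- (U (node n u (t, x) j) - U (node n v (t, y) j)) \<le> K * \<bar>?h\<bar>"
        "L (u j) - L (v j) \<le> CL * (2 * \<bar>?h\<bar>)" "- (a * (u j - v j)) \<le> \<bar>a\<bar> * (2 * \<bar>?h\<bar>)"
        using abs_le_D1 abs_le_D2 by blast+
      then show ?thesis unfolding stage_def C4_def by (simp add: algebra_simps)
    qed
    have "val n a (t, x) \<le> (\<Sum>j<?N. disc n ^ j * step n * stage n a u (t, x) j)
        + disc n ^ ?N * val n a (node n v (t, y) ?N)"
      using dynamic_programming_le[OF n' u, of a "(t, x)" ?N] unfolding end_eq .
    also have "(\<Sum>j<?N. disc n ^ j * step n * stage n a u (t, x) j)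
        \<le> (\<Sum>j<?N. disc n ^ j * step n * (stage n a v (t, y) j + C4 * \<bar>?h\<bar>))"
      by (intro sum_mono mult_left_mono stage_le w_pos)
    also have "\<dots> = (\<Sum>j<?N. disc n ^ j * step n * stage n a v (t, y) j)
        + (\<Sum>j<?N. disc n ^ j * step n * (C4 * \<bar>?h\<bar>))"
      by (simp add: distrib_left sum.distrib)
    also have "(\<Sum>j<?N. disc n ^ j * step n * (C4 * \<bar>?h\<bar>)) \<le> C4 * \<bar>?h\<bar>"
      using C4 by (intro sum_weights_le n') auto
    finally show "val n a (t, x) \<le> val n a (t, y) + C4 * \<bar>?h\<bar> + \<epsilon>'" using opt \<epsilon>(3) by linarith
  qed
  \<comment> \<open>Beyond distance 1 the oscillation bound suffices, whence \<open>Co\<close> in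
    the constant.\<close>
  have "val n a (t, x) \<le> val n a (t, y) + (C4 + Co) * \<bar>x - y\<bar>" if n: "n0 \<le> n" for n t x y
  proof (cases "\<bar>x - y\<bar> \<le> 1")
    case True
    moreover have "0 \<le> Co * \<bar>x - y\<bar>" using n2(2) by simp
    ultimately show ?thesis using near[OF n, of x y t] by (simp add: distrib_right)
  next
    case False
    then have "Co * 1 \<le> (C4 + Co) * \<bar>x - y\<bar>" using n2(2) C4 by (intro mult_mono) auto
    then show ?thesis using n2(3)[of n t x y] n unfolding n0_def by simp
  qed
  moreover have "n0 \<ge> 2" "0 \<le> C4 + Co" using n1 n2 C4 by (auto simp: n0_def)
  ultimately show ?thesis by blast
qed

section \<open>One step of the scheme and regularity in time\<close>

lemma one_step_le:
  assumes n: "2 \<le> n" and v: "\<bar>v\<bar> \<le> n"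
  shows "val n a (t, x) \<le> step n * (L v - a * v - U (t, x) - val n a (t - step n, x - step n * v) / n)
    + val n a (t - step n, x - step n * v)"
proof -
  have "(\<lambda>_. v) \<in> controls n" using v by (simp add: controls_def)
  from dynamic_programming_le[OF n this, of a "(t, x)" 1]
  have "val n a (t, x) \<le> step n * (L v - a * v - U (t, x)) + disc n * val n a (t - step n, x - step n * v)"
    by (simp add: stage_def node_def)
  \<comment> \<open>In this form the discount becomes a running cost, minus the value divided by
    \<open>n\<close>; along a suitable subsequence it approaches the constant of the cell
    problem.\<close>
  also have "disc n = 1 - step n / n" using one_minus_disc[OF n] by simp
  finally show ?thesis by (simp add: algebra_simps)
qed

lemma one_step_ge:
  assumes n: "2 \<le> n" and \<epsilon>: "0 < \<epsilon>"
  shows "\<exists>v. \<bar>v\<bar> \<le> n \<and> step n * (L v - a * v - U (t, x) - val n a (t - step n, x - step n * v) / n)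
    + val n a (t - step n, x - step n * v) \<le> val n a (t, x) + \<epsilon>"
proof -
  obtain v where v: "v \<in> controls n"
    and "(\<Sum>j<1. disc n ^ j * step n * stage n a v (t, x) j) + disc n ^ 1 * val n a (node n v (t, x) 1)
      \<le> val n a (t, x) + \<epsilon>"
    using dynamic_programming_ge[OF n \<epsilon>] by blast
  then have "step n * (L (v 0) - a * v 0 - U (t, x)) + disc n * val n a (t - step n, x - step n * v 0)
      \<le> val n a (t, x) + \<epsilon>"
    by (simp add: stage_def node_def)
  moreover have "disc n = 1 - step n / n" using one_minus_disc[OF n] by simp
  ultimately show ?thesis using controls_bound[OF v, of 0]
    by (intro exI[of _ "v 0"]) (simp add: algebra_simps)
qed

text \<open>Resting for one step bounds the value from above. For the lower bound, the displacement
  in an almost optimal first step is undone by the spatial Lipschitz estimate, and coercivity pays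
  for it.\<close>

lemma val_lipschitz_step:
  "\<exists>n0\<ge>2. \<exists>C\<ge>0. \<forall>n\<ge>n0. \<forall>t x. \<bar>val n a (t, x) - val n a (t - step n, x)\<bar> \<le> C * step n"
proof -
  obtain n1 C0 where n1: "n1 \<ge> 2" "C0 \<ge> 0" "\<And>n z. n \<ge> n1 \<Longrightarrow> \<bar>val n a z\<bar> \<le> real n * C0"
    using val_abs_le[of a] by metis
  obtain n2 C where n2: "n2 \<ge> 2" "C \<ge> 0"
    "\<And>n t x y. n \<ge> n2 \<Longrightarrow> val n a (t, x) \<le> val n a (t, y) + C * \<bar>x - y\<bar>"
    using val_lipschitz_space[of a] by metis
  \<comment> \<open>With the spatial Lipschitz constant \<open>C\<close> as slope, the term
    \<open>C * \<bar>v\<bar>\<close> caused by the displacement cancels however large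
    \<open>v\<close> is.\<close>
  obtain C2 where C2: "C2 \<ge> 0" "\<And>v. C * \<bar>v\<bar> - C2 \<le> L v - a * v" using coercive[OF n2(2)] by auto
  define D where "D = \<bar>L 0\<bar> + C2 + \<bar>m\<bar> + \<bar>M\<bar> + C0 + 1"
  have "\<bar>val n a (t, x) - val n a (t - step n, x)\<bar> \<le> D * step n" if n: "max n1 n2 \<le> n" for n t x
  proof -
    have nn: "n1 \<le> n" "n2 \<le> n" "2 \<le> n" using n n1(1) by auto
    note pos = step_pos[OF nn(3)]
    have E: "\<bar>val n a z / n\<bar> \<le> C0" for z
      using n1(3)[OF nn(1), of z] nn(3) by (simp add: abs_divide divide_le_eq mult.commute)
    have "val n a (t, x) \<le> step n * (L 0 - U (t, x) - val n a (t - step n, x) / n) + val n a (t - step n, x)"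
      using one_step_le[OF nn(3), of 0 a t x] by simp
    also have "step n * (L 0 - U (t, x) - val n a (t - step n, x) / n) \<le> step n * D"
      using pos E[of "(t - step n, x)"] U_lower[of "(t, x)"] C2(1) unfolding D_def
      by (intro mult_left_mono) linarith+
    finally have upper: "val n a (t, x) \<le> step n * D + val n a (t - step n, x)" by simp
    \<comment> \<open>The tolerance \<open>step n\<close> is of the size of the claim and accounts
      for the summand 1 in \<open>D\<close>.\<close>
    obtain v where v: "step n * (L v - a * v - U (t, x) - val n a (t - step n, x - step n * v) / n)
        + val n a (t - step n, x - step n * v) \<le> val n a (t, x) + step n"
      using one_step_ge[OF nn(3) pos] by blast
    have "val n a (t - step n, x) \<le> val n a (t - step n, x - step n * v) + step n * (C * \<bar>v\<bar>)"
      using n2(3)[OF nn(2), of "t - step n" x "x - step n * v"] pos by (simp add: abs_mult mult_ac)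
    moreover have "step n * (C * \<bar>v\<bar> - (D - 1)) 
        \<le> step n * (L v - a * v - U (t, x) - val n a (t - step n, x - step n * v) / n)"
      using pos C2(2)[of v] E[of "(t - step n, x - step n * v)"] U_upper[of "(t, x)"] unfolding D_def
      by (intro mult_left_mono) linarith+
    ultimately have "val n a (t - step n, x) \<le> val n a (t, x) + step n * D"
      using v by (simp add: algebra_simps)
    with upper show ?thesis by (simp add: abs_le_iff mult.commute)
  qed
  moreover have "D \<ge> 0" using C2(1) n1(2) by (simp add: D_def)
  moreover have "max n1 n2 \<ge> 2" using n1(1) by simp
  ultimately show ?thesis by blast
qed

text \<open>In time, the one-step estimate is iterated along whole steps; the remainder of at most
  one step is left to \<open>val_lipschitz_time\<close> and produces the error
  \<open>K / n\<close>.\<close>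

lemma val_asymptotically_lipschitz:
  "\<exists>n0\<ge>2. \<exists>C\<ge>0. \<forall>n\<ge>n0. \<forall>y z. \<bar>val n a y - val n a z\<bar> \<le> C * dist y z + K / n"
proof -
  obtain n1 C1 where n1: "n1 \<ge> 2" "C1 \<ge> 0"
    "\<And>n t x y. n \<ge> n1 \<Longrightarrow> val n a (t, x) \<le> val n a (t, y) + C1 * \<bar>x - y\<bar>"
    using val_lipschitz_space[of a] by metis
  obtain n2 C2 where n2: "n2 \<ge> 2" "C2 \<ge> 0"
    "\<And>n t x. n \<ge> n2 \<Longrightarrow> \<bar>val n a (t, x) - val n a (t - step n, x)\<bar> \<le> C2 * step n"
    using val_lipschitz_step[of a] by metis
  have time: "\<bar>val n a (t, x) - val n a (s, x)\<bar> \<le> C2 * (t - s) + K / n"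
    if n: "max n1 n2 \<le> n" and "s \<le> t" for n t s x
  proof -
    have nn: "n2 \<le> n" "2 \<le> n" using n n1(1) by auto
    note pos = step_pos[OF nn(2)]
    have iter: "\<bar>val n a (t, x) - val n a (t - k * step n, x)\<bar> \<le> C2 * (k * step n)" for k :: nat
    proof (induction k)
      case (Suc k)
      have "t - real (Suc k) * step n = t - k * step n - step n" by (simp add: algebra_simps)
      then show ?case using n2(3)[OF nn(1), of "t - k * step n" x] Suc.IH
        by (simp add: algebra_simps)
    qed simp
    define k where "k = nat \<lfloor>(t - s) / step n\<rfloor>"
    have "0 \<le> (t - s) / step n" using \<open>s \<le> t\<close> pos by simp
    then have "real k \<le> (t - s) / step n" "(t - s) / step n \<le> k + 1" unfolding k_def by linarith+
    then have k: "k * step n \<le> t - s" "t - s \<le> k * step n + step n"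
      using pos by (simp_all add: le_divide_eq divide_le_eq distrib_right)
    have "\<bar>val n a (t - k * step n, x) - val n a (s, x)\<bar> \<le> n * (K * \<bar>t - k * step n - s\<bar>)"
      using val_lipschitz_time[OF nn(2), of a "t - k * step n" x s] 
        val_lipschitz_time[OF nn(2), of a s x "t - k * step n"] by (simp add: abs_le_iff abs_minus_commute)
    also have "\<dots> \<le> n * (K * step n)"
      using k K_nonneg by (intro mult_left_mono) auto
    also have "\<dots> = K / n" using nn(2) by (simp add: step_def power2_eq_square)
    finally have "\<bar>val n a (t - k * step n, x) - val n a (s, x)\<bar> \<le> K / n" .
    moreover have "C2 * (k * step n) \<le> C2 * (t - s)" using k(1) n2(2) by (rule mult_left_mono)
    ultimately show ?thesis using iter[of k] by linarith
  qed
  have "\<bar>val n a y - val n a z\<bar> \<le> (C1 + C2) * dist y z + K / n" if n: "max n1 n2 \<le> n" for n y z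
  proof -
    obtain t x s x' where yz: "y = (t, x)" "z = (s, x')" by fastforce
    have "\<bar>val n a (t, x) - val n a (s, x)\<bar> \<le> C2 * \<bar>t - s\<bar> + K / n"
      using time[OF n, of s t x] time[OF n, of t s x] by (cases "s \<le> t") (auto simp: abs_minus_commute)
    moreover have "\<bar>val n a (s, x) - val n a (s, x')\<bar> \<le> C1 * \<bar>x - x'\<bar>"
      using n1(3)[of n s x x'] n1(3)[of n s x' x] n by (simp add: abs_le_iff abs_minus_commute)
    moreover have "C2 * \<bar>t - s\<bar> \<le> C2 * dist y z" "C1 * \<bar>x - x'\<bar> \<le> C1 * dist y z"
      using dist_fst_le[of y z] dist_snd_le[of y z] n1(2) n2(2) yz
      by (auto simp: dist_real_def intro!: mult_left_mono)
    ultimately show ?thesis unfolding yz distrib_right by linarith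
  qed
  moreover have "max n1 n2 \<ge> 2" "C1 + C2 \<ge> 0" using n1 n2 by auto
  ultimately show ?thesis by blast
qed

subsection \<open>Passage to the limit\<close>

lemma U_cont: "continuous_on UNIV U"
proof -
  have "(2 * K)-lipschitz_on UNIV U"
  proof (rule lipschitz_onI)
    fix y z
    have "\<bar>U y - U z\<bar> \<le> K * (\<bar>fst y - fst z\<bar> + \<bar>snd y - snd z\<bar>)"
      using U_lipschitz[of "fst y" "snd y" "fst z" "snd z"] by simp
    also have "\<dots> \<le> K * (dist y z + dist y z)"
      using dist_fst_le[of y z] dist_snd_le[of y z] K_nonneg
      by (intro mult_left_mono add_mono) (auto simp: dist_real_def)
    finally show "dist (U y) (U z) \<le> 2 * K * dist y z" by (simp add: dist_real_def)
  qed (use K_nonneg in simp)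
  then show ?thesis by (rule lipschitz_on_continuous_on)
qed

text \<open>At a maximum, the scheme is tested with one fixed velocity dual to
  \<open>partial_x \<phi> z\<close>. At a minimum it selects velocities that may be unbounded;
  Young's inequality removes them before the limit is taken. The condition on
  \<open>\<tau> n * R n\<close> makes the point one step back converge to \<open>z\<close>.\<close>

lemma viscosity_solution_limit:
  fixes w :: "nat \<Rightarrow> real \<times> real \<Rightarrow> real" and \<tau> \<eta> R :: "nat \<Rightarrow> real"
  assumes unif: "uniform_limit UNIV w s sequentially" and cont: "continuous_on UNIV s"
    and \<tau>: "\<And>n. 0 < \<tau> n" "\<tau> \<longlonglongrightarrow> 0" and \<eta>: "\<eta> \<longlonglongrightarrow> 0"
    and R: "filterlim R at_top sequentially" "(\<lambda>n. \<tau> n * R n) \<longlonglongrightarrow> 0"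
    and le: "\<And>n v t x. \<bar>v\<bar> \<le> R n \<Longrightarrow>
      w n (t, x) \<le> \<tau> n * (L v - a * v - U (t, x) + h + \<eta> n) + w n (t - \<tau> n, x - \<tau> n * v)"
    and ge: "\<And>n t x. \<exists>v. \<bar>v\<bar> \<le> R n \<and>
      \<tau> n * (L v - a * v - U (t, x) + h - \<eta> n) + w n (t - \<tau> n, x - \<tau> n * v) \<le> w n (t, x)"
  shows "viscosity_solution H0 U (\<lambda>(t, x). a * x - h * t + s (t, x))"
  unfolding viscosity_solution_def
proof (intro conjI allI impI)
  show "continuous_on UNIV (\<lambda>(t, x). a * x - h * t + s (t, x))"
    using cont by (auto simp: case_prod_beta' intro!: continuous_intros)
  fix \<phi> :: "real \<times> real \<Rightarrow> real" and z :: "real \<times> real" assume \<phi>: "C1_plane \<phi>"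
  \<comment> \<open>The affine part of the solution moves to the test function, so that
    \<open>s\<close> alone is tested. \<open>\<Phi>\<close> adds the penalty, with
    \<open>\<sigma> = 1\<close> for maxima and \<open>\<sigma> = -1\<close> for minima; the
    derivative of the penalty vanishes at \<open>z\<close>, so \<open>A\<close> and \<open>B\<close>
    do not depend on \<open>\<sigma>\<close> there.\<close>
  define \<psi> where "\<psi> y = \<phi> y - a * snd y + h * fst y" for y
  define \<Phi> where "\<Phi> \<sigma> y = \<psi> y + \<sigma> * (dist y z)\<^sup>2" for \<sigma> y
  define A where "A \<sigma> y = partial_t \<phi> y + h + \<sigma> * (2 * (fst y - fst z))" for \<sigma> y
  define B where "B \<sigma> y = partial_x \<phi> y - a + \<sigma> * (2 * (snd y - snd z))" for \<sigma> y
  have dist2: "(dist y z)\<^sup>2 = (fst y - fst z)\<^sup>2 + (snd y - snd z)\<^sup>2" for y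
    by (simp add: dist_prod_def dist_real_def)
  have "(\<Phi> \<sigma> has_derivative (\<lambda>d. A \<sigma> y * fst d + B \<sigma> y * snd d)) (at y)" for \<sigma> y
    unfolding \<Phi>_def \<psi>_def dist2 A_def B_def
    by (rule derivative_eq_intros C1_plane_has_derivative[OF \<phi>] refl | simp)+
       (auto simp: algebra_simps)
  then have mvt: "\<exists>\<xi>\<in>closed_segment y' y. \<Phi> \<sigma> y - \<Phi> \<sigma> y' = A \<sigma> \<xi> * (fst y - fst y') + B \<sigma> \<xi> * (snd y - snd y')"
    for \<sigma> y y' by (rule mean_value_plane)
  have contAB: "isCont (A \<sigma>) y" "isCont (B \<sigma>) y" for \<sigma> y
  proof -
    have "isCont (partial_t \<phi>) y" "isCont (partial_x \<phi>) y"
      using \<phi> unfolding C1_plane_def by (metis UNIV_I continuous_on_eq_continuous_at open_UNIV)+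
    then show "isCont (A \<sigma>) y" "isCont (B \<sigma>) y"
      unfolding A_def[abs_def] B_def[abs_def] by (auto intro!: continuous_intros)
  qed
  have AB_z: "A \<sigma> z = partial_t \<phi> z + h" "B \<sigma> z = partial_x \<phi> z - a" for \<sigma>
    by (simp_all add: A_def B_def)
  have U_z: "isCont U z" using U_cont by (metis UNIV_I continuous_on_eq_continuous_at open_UNIV)
  have H0_y: "isCont H0 y" for y using H0_cont by (simp add: continuous_on_eq_continuous_at)
  have predecessor: "(\<lambda>n. (fst (\<zeta> n) - \<tau> n, snd (\<zeta> n) - \<tau> n * v n)) \<longlonglongrightarrow> z"
    if "\<zeta> \<longlonglongrightarrow> z" "\<forall>\<^sub>F n in sequentially. \<bar>v n\<bar> \<le> R n" for \<zeta> v
  proof -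
    have "(\<lambda>n. \<tau> n * v n) \<longlonglongrightarrow> 0"
    proof (rule Lim_null_comparison[OF _ R(2)])
      show "\<forall>\<^sub>F n in sequentially. norm (\<tau> n * v n) \<le> \<tau> n * R n"
        using that(2) by eventually_elim (use \<tau>(1) in \<open>simp add: abs_mult less_imp_le\<close>)
    qed
    then have "(\<lambda>n. (fst (\<zeta> n) - \<tau> n, snd (\<zeta> n) - \<tau> n * v n)) \<longlonglongrightarrow> (fst z - 0, snd z - 0)"
      by (intro tendsto_intros that(1) \<tau>(2))
    then show ?thesis by simp
  qed
  have in_cball: "\<forall>\<^sub>F n in sequentially. y n \<in> cball z r" if "y \<longlonglongrightarrow> z" "0 < r" for y r
    using tendstoD[OF that] by eventually_elim (simp add: dist_commute less_imp_le)
  \<comment> \<open>The tolerance \<open>(\<tau> n)\<^sup>2\<close> still tends to 0 after division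
    by the step \<open>\<tau> n\<close>.\<close>
  have \<tau>2: "0 < (\<tau> n)\<^sup>2" "(\<lambda>n. (\<tau> n)\<^sup>2) \<longlonglongrightarrow> 0" for n
    using \<tau>(1)[of n] tendsto_power[OF \<tau>(2), of 2] by simp_all
  {
    assume max: "local_max_at (\<lambda>w. (case w of (t, x) \<Rightarrow> a * x - h * t + s (t, x)) - \<phi> w) z"
    then have "local_max_at (\<lambda>y. s y - \<psi> y) z"
      by (simp add: \<psi>_def case_prod_beta algebra_simps)
    then obtain r \<zeta> where r: "r > 0" and \<zeta>: "\<zeta> \<longlonglongrightarrow> z"
      and near: "\<forall>\<^sub>F n in sequentially. \<forall>y\<in>cball z r.
        w n y - \<psi> y - (dist y z)\<^sup>2 \<le> w n (\<zeta> n) - \<psi> (\<zeta> n) - (dist (\<zeta> n) z)\<^sup>2 + (\<tau> n)\<^sup>2"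
      by (rule almost_maximal_points[OF unif _ \<tau>2])
    obtain v where v: "L v = partial_x \<phi> z * v - H0 (partial_x \<phi> z)" using dual by blast
    define y where "y n = (fst (\<zeta> n) - \<tau> n, snd (\<zeta> n) - \<tau> n * v)" for n
    have vR: "\<forall>\<^sub>F n in sequentially. \<bar>v\<bar> \<le> R n" using R(1) by (auto simp: filterlim_at_top)
    have y: "y \<longlonglongrightarrow> z" using predecessor[OF \<zeta> vR] by (simp add: y_def[abs_def])
    obtain \<xi> where \<xi>: "\<And>n. \<xi> n \<in> closed_segment (y n) (\<zeta> n)"
      "\<And>n. \<Phi> 1 (\<zeta> n) - \<Phi> 1 (y n) = A 1 (\<xi> n) * \<tau> n + B 1 (\<xi> n) * (\<tau> n * v)"
    proof -
      have "\<exists>\<xi>. \<xi> \<in> closed_segment (y n) (\<zeta> n)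
        \<and> \<Phi> 1 (\<zeta> n) - \<Phi> 1 (y n) = A 1 \<xi> * \<tau> n + B 1 \<xi> * (\<tau> n * v)" for n
        using mvt[of "y n" "\<zeta> n" "1"] unfolding Bex_def by (simp add: y_def del: split_paired_Ex)
      then show ?thesis using that by metis
    qed
    have "\<xi> \<longlonglongrightarrow> z" by (rule tendsto_in_closed_segment[OF y \<zeta> \<xi>(1)])
    note AB = isCont_tendsto_compose[OF contAB(1) this] isCont_tendsto_compose[OF contAB(2) this]
    have ev: "\<forall>\<^sub>F n in sequentially. A 1 (\<xi> n) + v * B 1 (\<xi> n) \<le> L v - a * v - U (\<zeta> n) + h + \<eta> n + \<tau> n"
      using near vR in_cball[OF y r]
    proof eventually_elim
      case (elim n)
      have "w n (\<zeta> n) \<le> \<tau> n * (L v - a * v - U (\<zeta> n) + h + \<eta> n) + w n (y n)"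
        using le[OF elim(2), of "fst (\<zeta> n)" "snd (\<zeta> n)"] by (simp add: y_def)
      moreover have "\<Phi> 1 (\<zeta> n) - \<Phi> 1 (y n) \<le> w n (\<zeta> n) - w n (y n) + (\<tau> n)\<^sup>2"
        using elim(1)[rule_format, OF elim(3)] unfolding \<Phi>_def by linarith
      ultimately have "\<tau> n * (A 1 (\<xi> n) + v * B 1 (\<xi> n))
          \<le> \<tau> n * (L v - a * v - U (\<zeta> n) + h + \<eta> n + \<tau> n)"
        unfolding \<xi>(2) by (simp add: algebra_simps power2_eq_square)
      then show ?case using \<tau>(1)[of n] by simp
    qed
    have "A 1 z + v * B 1 z \<le> L v - a * v - U z + h + 0 + 0"
      by (intro tendsto_le[OF _ _ _ ev] tendsto_intros AB \<eta> \<tau>(2)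
        isCont_tendsto_compose[OF U_z \<zeta>]) auto
    then show "partial_t \<phi> z + H0 (partial_x \<phi> z) + U z \<le> 0"
      unfolding AB_z v by (simp add: algebra_simps)
  next
    assume min: "local_min_at (\<lambda>w. (case w of (t, x) \<Rightarrow> a * x - h * t + s (t, x)) - \<phi> w) z"
    then have "local_max_at (\<lambda>y. - s y - - \<psi> y) z"
      unfolding local_max_at_def local_min_at_def
      by (rule eventually_mono) (simp add: \<psi>_def case_prod_beta algebra_simps)
    then obtain r \<zeta> where r: "r > 0" and \<zeta>: "\<zeta> \<longlonglongrightarrow> z"
      and near: "\<forall>\<^sub>F n in sequentially. \<forall>y\<in>cball z r.
        - w n y - - \<psi> y - (dist y z)\<^sup>2 \<le> - w n (\<zeta> n) - - \<psi> (\<zeta> n) - (dist (\<zeta> n) z)\<^sup>2 + (\<tau> n)\<^sup>2"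
      by (rule almost_maximal_points[OF uniform_limit_uminus[OF unif] _ \<tau>2])
    obtain v where v: "\<And>n. \<bar>v n\<bar> \<le> R n" "\<And>n. \<tau> n * (L (v n) - a * v n - U (\<zeta> n) + h - \<eta> n)
        + w n (fst (\<zeta> n) - \<tau> n, snd (\<zeta> n) - \<tau> n * v n) \<le> w n (\<zeta> n)"
    proof -
      have "\<exists>v. \<bar>v\<bar> \<le> R n \<and> \<tau> n * (L v - a * v - U (\<zeta> n) + h - \<eta> n)
          + w n (fst (\<zeta> n) - \<tau> n, snd (\<zeta> n) - \<tau> n * v) \<le> w n (\<zeta> n)" for n
        using ge[of n "fst (\<zeta> n)" "snd (\<zeta> n)"] by simp
      then show ?thesis using that by metis
    qed
    define y where "y n = (fst (\<zeta> n) - \<tau> n, snd (\<zeta> n) - \<tau> n * v n)" for n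
    have y: "y \<longlonglongrightarrow> z" using predecessor[OF \<zeta>, of v] v(1) by (simp add: y_def[abs_def])
    obtain \<xi> where \<xi>: "\<And>n. \<xi> n \<in> closed_segment (y n) (\<zeta> n)"
      "\<And>n. \<Phi> (-1) (\<zeta> n) - \<Phi> (-1) (y n) = A (-1) (\<xi> n) * \<tau> n + B (-1) (\<xi> n) * (\<tau> n * v n)"
    proof -
      have "\<exists>\<xi>. \<xi> \<in> closed_segment (y n) (\<zeta> n)
        \<and> \<Phi> (-1) (\<zeta> n) - \<Phi> (-1) (y n) = A (-1) \<xi> * \<tau> n + B (-1) \<xi> * (\<tau> n * v n)" for n
        using mvt[of "y n" "\<zeta> n" "-1"] unfolding Bex_def by (simp add: y_def del: split_paired_Ex)
      then show ?thesis using that by metis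
    qed
    have "\<xi> \<longlonglongrightarrow> z" by (rule tendsto_in_closed_segment[OF y \<zeta> \<xi>(1)])
    note AB = isCont_tendsto_compose[OF contAB(1) this] isCont_tendsto_compose[OF contAB(2) this]
    have ev: "\<forall>\<^sub>F n in sequentially. h - \<eta> n - \<tau> n \<le> A (-1) (\<xi> n) + H0 (a + B (-1) (\<xi> n)) + U (\<zeta> n)"
      using near in_cball[OF y r]
    proof eventually_elim
      case (elim n)
      have "\<Phi> (-1) (\<zeta> n) - \<Phi> (-1) (y n) \<ge> w n (\<zeta> n) - w n (y n) - (\<tau> n)\<^sup>2"
        using elim(1)[rule_format, OF elim(2)] unfolding \<Phi>_def by linarith
      then have "\<tau> n * (L (v n) - a * v n - U (\<zeta> n) + h - \<eta> n - \<tau> n)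
          \<le> \<tau> n * (A (-1) (\<xi> n) + v n * B (-1) (\<xi> n))"
        using v(2)[of n] unfolding \<xi>(2) y_def[symmetric] by (simp add: algebra_simps power2_eq_square)
      then have "L (v n) - a * v n - U (\<zeta> n) + h - \<eta> n - \<tau> n \<le> A (-1) (\<xi> n) + v n * B (-1) (\<xi> n)"
        using \<tau>(1)[of n] by simp
      \<comment> \<open>Young's inequality at \<open>a + B (-1) (\<xi> n)\<close> replaces all terms
        in \<open>v n\<close> by a value of \<open>H0\<close>, which converges by
        continuity.\<close>
      then show ?case
        using young[of "a + B (-1) (\<xi> n)" "v n"] by (simp add: algebra_simps)
    qed
    have "h - 0 - 0 \<le> A (-1) z + H0 (a + B (-1) z) + U z"
      by (intro tendsto_le[OF _ _ _ ev] tendsto_intros AB \<eta> \<tau>(2)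
        isCont_tendsto_compose[OF U_z \<zeta>] isCont_tendsto_compose[OF H0_y]) auto
    then show "0 \<le> partial_t \<phi> z + H0 (partial_x \<phi> z) + U z"
      unfolding AB_z by simp
  }
qed

section \<open>The effective Hamiltonian and its periodic correctors\<close>

definition approx_H :: "nat \<Rightarrow> real \<Rightarrow> real" where "approx_H n a = - val n a 0 / n"

lemma approx_H_bounds: "\<forall>\<^sub>F n in sequentially. H0 a + m \<le> approx_H n a \<and> approx_H n a \<le> H0 a + M"
proof -
  obtain n0 where n0: "n0 \<ge> 2" "\<And>n z. n \<ge> n0 \<Longrightarrow> val n a z \<le> n * (- H0 a - m)"
    using val_upper[of a] by metis
  show ?thesis
    using eventually_ge_at_top[of n0]
  proof eventually_elim
    case (elim n)
    then have "real n * (H0 a + m) \<le> - val n a 0" "- val n a 0 \<le> real n * (H0 a + M)"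
      using n0(2)[OF elim, of 0] val_lower[of n a 0] n0(1) by (simp_all add: algebra_simps)
    then show ?case unfolding approx_H_def using elim n0(1) by (simp add: field_simps)
  qed
qed

lemma approx_H_convex:
  assumes "2 \<le> n" "0 \<le> \<theta>" "\<theta> \<le> 1"
  shows "approx_H n ((1 - \<theta>) * a + \<theta> * b) \<le> (1 - \<theta>) * approx_H n a + \<theta> * approx_H n b"
proof -
  have "- val n ((1 - \<theta>) * a + \<theta> * b) 0 / n \<le> - ((1 - \<theta>) * val n a 0 + \<theta> * val n b 0) / n"
    using val_concave[OF assms, of a 0 b] by (intro divide_right_mono) auto
  also have "\<dots> = (1 - \<theta>) * approx_H n a + \<theta> * approx_H n b"
    unfolding approx_H_def by (simp add: add_divide_distrib diff_divide_distrib)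
  finally show ?thesis unfolding approx_H_def .
qed

text \<open>With \<open>a\<close> fixed, one subsequence realises the upper limit and a further one
  makes the normalised values converge. \<open>one_step_le\<close> and \<open>one_step_ge\<close>
  become the scheme of \<open>viscosity_solution_limit\<close> once minus value over
  \<open>n\<close> is replaced by \<open>h\<close>, at the expense of \<open>\<eta>\<close>.\<close>

lemma cell_problem:
  assumes lim: "limsup (\<lambda>n. ereal (approx_H n a)) = ereal h"
  shows "\<exists>s. continuous_on UNIV s \<and> periodic_plane s \<and>
    viscosity_solution H0 U (\<lambda>(t, x). a * x - h * t + s (t, x))"
proof -
  obtain n0 C where n0: "n0 \<ge> 2" "C \<ge> 0"
    "\<And>n y z. n \<ge> n0 \<Longrightarrow> \<bar>val n a y - val n a z\<bar> \<le> C * dist y z + K / n"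
    using val_asymptotically_lipschitz[of a] by metis
  obtain r where r: "strict_mono r" "(\<lambda>k. ereal (approx_H (r k) a)) \<longlonglongrightarrow> ereal h"
    using limsup_subseq_lim[of "\<lambda>n. ereal (approx_H n a)"] unfolding lim by (auto simp: o_def)
  \<comment> \<open>The shift by \<open>n0\<close> makes the estimates hold for every index rather
    than eventually.\<close>
  define N where "N k = r (k + n0)" for k
  have N_ge: "n0 \<le> N k" "k \<le> N k" for k
    using seq_suble[OF r(1), of "k + n0"] by (auto simp: N_def)
  have N2: "2 \<le> N k" for k using N_ge(1)[of k] n0(1) by simp
  have N_top: "filterlim N at_top sequentially"
    using N_ge(2) by (auto intro: filterlim_at_top_mono[OF filterlim_ident])
  have N_inv: "(\<lambda>k. c / real (N k)) \<longlonglongrightarrow> 0" for c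
    by (intro tendsto_divide_0[OF tendsto_const]
        filterlim_at_top_imp_at_infinity filterlim_compose[OF filterlim_real_sequentially N_top])
  have N_lim: "(\<lambda>k. approx_H (N k) a) \<longlonglongrightarrow> h"
    using LIMSEQ_ignore_initial_segment[OF r(2), of n0] by (simp add: N_def)
  define w where "w k z = val (N k) a z - val (N k) a 0" for k z
  have w_per: "periodic_plane (w k)" for k
    using val_periodic[OF N2] by (simp add: periodic_plane_def w_def)
  have w_0: "w k 0 = 0" for k by (simp add: w_def)
  have w_lip: "\<bar>w k y - w k z\<bar> \<le> C * dist y z + K / N k" for k y z
    using n0(3)[OF N_ge(1)] by (simp add: w_def)
  obtain q s where q: "strict_mono (q :: nat \<Rightarrow> nat)" and unif: "uniform_limit UNIV (\<lambda>k. w (q k)) s sequentially"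
    and s: "continuous_on UNIV s" "periodic_plane s"
    by (rule asymptotically_lipschitz_subsequence[OF w_per w_lip n0(2) N_inv w_0])
  define D where "D = 2 * C + K"
  have w_bound: "\<bar>w k z\<bar> \<le> D" for k z
  proof -
    let ?y = "(frac (fst z), frac (snd z))"
    have "norm ?y \<le> 2"
      using norm_Pair_le[of "frac (fst z)" "frac (snd z)"] frac_lt_1[of "fst z"] frac_lt_1[of "snd z"] by simp
    then have "C * dist ?y 0 \<le> C * 2" using n0(2) by (intro mult_left_mono) auto
    moreover have "K / N k \<le> K" using N2[of k] mult_left_mono[of 1 "real (N k)" K] K_nonneg by (simp add: divide_le_eq)
    moreover have "\<bar>w k ?y - w k 0\<bar> \<le> C * dist ?y 0 + K / N k" by (rule w_lip)
    moreover have "w k z = w k ?y" using periodic_plane_frac[OF w_per, of k "fst z" "snd z"] by simp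
    ultimately show ?thesis unfolding D_def w_0 by simp
  qed
  \<comment> \<open>The first term is the error at the origin, \<open>D / N k\<close> the deviation
    elsewhere; the additional \<open>1 / N k\<close> is reserved for the tolerance in
    \<open>one_step_ge\<close>, divided by the step.\<close>
  define \<eta> where "\<eta> k = \<bar>approx_H (N k) a - h\<bar> + (D + 1) / N k" for k
  have \<eta>: "\<eta> \<longlonglongrightarrow> 0"
  proof -
    have "(\<lambda>k. \<bar>approx_H (N k) a - h\<bar> + (D + 1) / N k) \<longlonglongrightarrow> \<bar>h - h\<bar> + 0"
      by (intro tendsto_intros N_lim N_inv)
    then show ?thesis by (simp add: \<eta>_def[abs_def])
  qed
  have near_h: "\<bar>- val (N k) a z / N k - h\<bar> \<le> \<eta> k - 1 / N k" for k z
  proof -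
    have "- val (N k) a z / N k - h = (approx_H (N k) a - h) - w k z / N k"
      using N2[of k] by (simp add: approx_H_def w_def diff_divide_distrib)
    also have "\<bar>\<dots>\<bar> \<le> \<bar>approx_H (N k) a - h\<bar> + \<bar>w k z\<bar> / N k"
      using abs_triangle_ineq4[of "approx_H (N k) a - h" "w k z / N k"] by simp
    also have "\<dots> \<le> \<bar>approx_H (N k) a - h\<bar> + D / N k"
      using w_bound by (intro add_left_mono divide_right_mono) auto
    finally show ?thesis by (simp add: \<eta>_def add_divide_distrib)
  qed
  have "viscosity_solution H0 U (\<lambda>(t, x). a * x - h * t + s (t, x))"
  proof (rule viscosity_solution_limit[OF unif s(1), of "\<lambda>k. step (N (q k))" "\<lambda>k. \<eta> (q k)" "\<lambda>k. N (q k)"])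
    show "0 < step (N (q k))" for k by (rule step_pos[OF N2])
    have "(\<lambda>k. (1 / N k) * (1 / N k)) \<longlonglongrightarrow> 0 * 0" by (intro tendsto_intros N_inv)
    then have "(\<lambda>k. step (N k)) \<longlonglongrightarrow> 0" by (simp add: step_def power2_eq_square)
    then show "(\<lambda>k. step (N (q k))) \<longlonglongrightarrow> 0" using LIMSEQ_subseq_LIMSEQ[OF _ q] by (force simp: o_def)
    show "(\<lambda>k. \<eta> (q k)) \<longlonglongrightarrow> 0" using LIMSEQ_subseq_LIMSEQ[OF \<eta> q] by (simp add: o_def)
    show "filterlim (\<lambda>k. real (N (q k))) at_top sequentially"
      using q N_top by (intro filterlim_compose[OF filterlim_real_sequentially]
          filterlim_compose[OF N_top] filterlim_subseq)
    have "step (N k) * N k = 1 / N k" for k using N2[of k] by (simp add: step_def power2_eq_square)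
    then show "(\<lambda>k. step (N (q k)) * N (q k)) \<longlonglongrightarrow> 0"
      using LIMSEQ_subseq_LIMSEQ[OF N_inv[of 1] q] by (simp add: o_def)
    show "w (q k) (t, x) \<le> step (N (q k)) * (L v - a * v - U (t, x) + h + \<eta> (q k))
        + w (q k) (t - step (N (q k)), x - step (N (q k)) * v)"
      if "\<bar>v\<bar> \<le> real (N (q k))" for k v t x
    proof -
      let ?n = "N (q k)" and ?y = "(t - step (N (q k)), x - step (N (q k)) * v)"
      have "- val ?n a ?y / ?n \<le> h + \<eta> (q k)"
        using near_h[of "q k" ?y] zero_le_divide_1_iff[of "real ?n"] by linarith
      then have "step ?n * (L v - a * v - U (t, x) - val ?n a ?y / ?n)
          \<le> step ?n * (L v - a * v - U (t, x) + h + \<eta> (q k))"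
        using step_pos[OF N2, of "q k"] by (intro mult_left_mono) auto
      then show ?thesis using one_step_le[OF N2 that, of a t x] unfolding w_def by linarith
    qed
    show "\<exists>v. \<bar>v\<bar> \<le> real (N (q k)) \<and> step (N (q k)) * (L v - a * v - U (t, x) + h - \<eta> (q k))
        + w (q k) (t - step (N (q k)), x - step (N (q k)) * v) \<le> w (q k) (t, x)" for k t x
    proof -
      let ?n = "N (q k)"
      have \<epsilon>: "0 < step ?n / ?n" using step_pos[OF N2] N2[of "q k"] by (intro divide_pos_pos) auto
      obtain v where v: "\<bar>v\<bar> \<le> real ?n"
        and opt: "step ?n * (L v - a * v - U (t, x) - val ?n a (t - step ?n, x - step ?n * v) / ?n)
          + val ?n a (t - step ?n, x - step ?n * v) \<le> val ?n a (t, x) + step ?n / ?n"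
        using one_step_ge[OF N2 \<epsilon>] by blast
      let ?y = "(t - step ?n, x - step ?n * v)"
      have "h - \<eta> (q k) \<le> - val ?n a ?y / ?n - 1 / ?n"
        using near_h[of "q k" ?y] by linarith
      then have "step ?n * (L v - a * v - U (t, x) + h - \<eta> (q k))
          \<le> step ?n * ((L v - a * v - U (t, x) - val ?n a ?y / ?n) - 1 / ?n)"
        using step_pos[OF N2, of "q k"] by (intro mult_left_mono) auto
      also have "\<dots> = step ?n * (L v - a * v - U (t, x) - val ?n a ?y / ?n) - step ?n / ?n"
        by (simp add: right_diff_distrib)
      finally show ?thesis using v opt unfolding w_def by (intro exI[of _ v]) linarith
    qed
  qed
  with s show ?thesis by blast
qed

text \<open>\<open>H\<close> is the upper limit along the whole sequence, so convexity compares
  three slopes at the same \<open>n\<close>: at the two end slopes the approximants are eventually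
  below \<open>H\<close> plus \<open>\<epsilon>\<close>. Subsequences enter only slope by
  slope.\<close>

lemma effective_hamiltonian:
  "\<exists>H. convex_on UNIV H \<and> (\<forall>a. m \<le> H a - H0 a \<and> H a - H0 a \<le> M) \<and>
    (\<forall>a. \<exists>s. continuous_on UNIV s \<and> periodic_plane s \<and>
      viscosity_solution H0 U (\<lambda>(t, x). a * x - H a * t + s (t, x)))"
proof -
  have "\<forall>a. \<exists>l. limsup (\<lambda>n. ereal (approx_H n a)) = ereal l \<and> H0 a + m \<le> l \<and> l \<le> H0 a + M"
    by (intro allI limsup_ereal_bounded approx_H_bounds)
  then obtain H where H: "\<And>a. limsup (\<lambda>n. ereal (approx_H n a)) = ereal (H a)"
    and bounds: "\<And>a. H0 a + m \<le> H a" "\<And>a. H a \<le> H0 a + M" by metis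
  have upper: "\<forall>\<^sub>F n in sequentially. approx_H n a < H a + \<epsilon>" if "\<epsilon> > 0" for a \<epsilon>
    using Limsup_lessD[of sequentially "\<lambda>n. ereal (approx_H n a)" "ereal (H a + \<epsilon>)"] that
    by (simp add: H)
  have "convex_on UNIV H"
  proof (rule convex_onI)
    fix \<theta> a b :: real assume \<theta>: "0 < \<theta>" "\<theta> < 1"
    have "H ((1 - \<theta>) * a + \<theta> * b) \<le> (1 - \<theta>) * H a + \<theta> * H b"
    proof (rule field_le_epsilon)
      fix \<epsilon> :: real assume "\<epsilon> > 0"
      from upper[OF this, of a] upper[OF this, of b] eventually_ge_at_top[of 2]
      have "\<forall>\<^sub>F n in sequentially. ereal (approx_H n ((1 - \<theta>) * a + \<theta> * b))
          \<le> ereal ((1 - \<theta>) * H a + \<theta> * H b + \<epsilon>)"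
      proof eventually_elim
        case (elim n)
        have "approx_H n ((1 - \<theta>) * a + \<theta> * b) \<le> (1 - \<theta>) * approx_H n a + \<theta> * approx_H n b"
          using elim \<theta> by (intro approx_H_convex) auto
        also have "\<dots> \<le> (1 - \<theta>) * (H a + \<epsilon>) + \<theta> * (H b + \<epsilon>)"
          using elim \<theta> by (intro add_mono mult_left_mono) auto
        also have "\<dots> = (1 - \<theta>) * H a + \<theta> * H b + \<epsilon>" by (simp add: algebra_simps)
        finally show ?case by simp
      qed
      from Limsup_bounded[OF this] show "H ((1 - \<theta>) * a + \<theta> * b) \<le> (1 - \<theta>) * H a + \<theta> * H b + \<epsilon>"
        by (simp add: H)
    qed
    then show "H ((1 - \<theta>) *\<^sub>R a + \<theta> *\<^sub>R b) \<le> (1 - \<theta>) * H a + \<theta> * H b" by simp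
  qed simp
  moreover have "m \<le> H a - H0 a" "H a - H0 a \<le> M" for a using bounds[of a] by linarith+
  ultimately show ?thesis using cell_problem[OF H] by (intro exI[of _ H] conjI allI)
qed

end

theorem theoremI:
  fixes H0 :: "real \<Rightarrow> real" and U :: "real \<times> real \<Rightarrow> real"
  assumes H0_C1: "H0 C1_differentiable_on UNIV"
    and H0_deriv_strict_mono: "strict_mono (deriv H0)"
    and H0_deriv_loc_lipschitz:
      "\<forall>P>0. \<exists>C>0. \<forall>p1\<in>{-P..P}. \<forall>p2\<in>{-P..P}.
         \<bar>deriv H0 p1 - deriv H0 p2\<bar> \<le> C * \<bar>p1 - p2\<bar>"
    and H0_superlinear: "\<forall>N>0. \<exists>P>0. \<forall>p. \<bar>p\<bar> > P \<longrightarrow> H0 p > N * \<bar>p\<bar>"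
    and U_C1: "C1_plane U"
    and U_x_lipschitz: "\<exists>K. K-lipschitz_on UNIV (partial_x U)"
    and U_periodic: "periodic_plane U"
  shows "\<exists>H :: real \<Rightarrow> real. convex_on UNIV H \<and>
    (\<forall>a. (LEAST u. u \<in> range U) \<le> H a - H0 a \<and>
         H a - H0 a \<le> (GREATEST u. u \<in> range U)) \<and>
    (\<forall>a. \<exists>s :: real \<times> real \<Rightarrow> real. continuous_on UNIV s \<and> periodic_plane s \<and>
         viscosity_solution H0 U (\<lambda>(t, x). a * x - H a * t + s (t, x)))"
proof -
  have diff: "H0 differentiable (at p)" for p
    using H0_C1 by (auto simp: C1_differentiable_on_eq)
  have "continuous_on UNIV (vector_derivative H0 \<circ> at)"
    using H0_C1 by (simp add: C1_differentiable_on_eq o_def)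
  moreover have "vector_derivative H0 \<circ> at = deriv H0"
  proof
    fix p
    have "DERIV H0 p :> deriv H0 p" using diff by (simp add: DERIV_deriv_iff_real_differentiable)
    then show "(vector_derivative H0 \<circ> at) p = deriv H0 p"
      unfolding has_real_derivative_iff_has_vector_derivative o_def by (rule vector_derivative_at)
  qed
  ultimately have cont: "continuous_on UNIV (deriv H0)" by simp
  have surj: "surj (deriv H0)"
    using H0_superlinear
    by (intro surj_deriv_superlinear[OF diff strict_mono_mono[OF H0_deriv_strict_mono] cont]) blast
  obtain K where K: "K \<ge> 0" "\<And>t s x y. \<bar>U (t, x) - U (s, y)\<bar> \<le> K * (\<bar>t - s\<bar> + \<bar>x - y\<bar>)"
    using C1_periodic_imp_lipschitz[OF U_C1 U_periodic] by blast
  have U_cont: "continuous_on UNIV U"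
    using U_C1 unfolding C1_plane_def by (blast intro: differentiable_imp_continuous_on)
  \<comment> \<open>With the extreme values of \<open>U\<close> for \<open>m\<close> and
    \<open>M\<close>, the general bounds on \<open>H a - H0 a\<close> become the stated
    ones.\<close>
  interpret tonelli H0 "legendre H0" U K "LEAST u. u \<in> range U" "GREATEST u. u \<in> range U"
  proof
    show "continuous_on UNIV H0"
      using diff by (intro continuous_at_imp_continuous_on) (auto intro: differentiable_imp_continuous_within)
    show "p * v - H0 p \<le> legendre H0 v" for p v
      by (rule fenchel_young[OF diff H0_deriv_strict_mono surj])
    show "\<exists>v. legendre H0 v = p * v - H0 p" for p
      by (rule legendre_attained[OF diff H0_deriv_strict_mono surj])
    show "\<exists>C\<ge>0. \<forall>v w. \<bar>v\<bar> \<le> A \<longrightarrow> \<bar>w\<bar> \<le> A \<longrightarrow>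
        \<bar>legendre H0 v - legendre H0 w\<bar> \<le> C * \<bar>v - w\<bar>" for A
      by (rule legendre_locally_lipschitz[OF diff H0_deriv_strict_mono surj])
  qed (rule K U_periodic LEAST_GREATEST_range_bounds[OF U_periodic U_cont])+
  show ?thesis by (rule effective_hamiltonian)
qed

end
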